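(* Let $n\ge1$ be an integer, $p$ a prime with $p\equiv1\pmod n$, and $l_1,\dots,l_s$ distinct primes, different from $p$ and not dividing $n$. Let $F=\mathbb{Q}(\zeta_n)$ with $\zeta_n$ a fixed primitive $n$-th root of unity, fix $n$-th roots $l_i^{1/n}$, and let $L=F(l_1^{1/n},\dots,l_s^{1/n})$. For $i=1,\dots,s$ let $\lambda_i\in\operatorname{Gal}(L/F)$ be the automorphism with $\lambda_i(l_i^{1/n})=\zeta_n l_i^{1/n}$ and $\lambda_i(l_j^{1/n})=l_j^{1/n}$ for $j\ne i$. Let $K_n(p)$ be the unique subfield of degree $n$ of $\mathbb{Q}(\zeta_p)$. Let $\wp$ be any prime of $F$ above $p$, and suppose the Frobenius element of $\wp$ in the abelian extension $L/F$ is $\mathrm{Fr}_{L/F}(\wp)=\lambda_1^{a_1}\cdots\lambda_s^{a_s}$. Then there is a generator $\tau$ of $\operatorname{Gal}(K_n(p)/\mathbb{Q})$ such that $\mathrm{Fr}_{K_n(p)/\mathbb{Q}}(l_i)=\tau^{a_i}$ for all $i=1,\dots,s$.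
   Context: Under these hypotheses $L/F$ is abelian with $\operatorname{Gal}(L/F)\cong\mu_n^s$, so $\operatorname{Gal}(L/F)=\langle\lambda_1\rangle\times\cdots\times\langle\lambda_s\rangle$ with each $\lambda_i$ of order $n$; $L/F$ is unramified at primes above $p$, and $K_n(p)/\mathbb{Q}$ is cyclic of degree $n$ and unramified at each $l_i$. $\mathrm{Fr}$ denotes the Frobenius automorphism. *)

theory Defs
  imports Complex_Main "HOL-Computational_Algebra.Polynomial"
begin

text \<open>Number fields are modelled as subfields of the complex numbers.\<close>

definition subfield :: "complex set \<Rightarrow> bool" where
  "subfield K \<longleftrightarrow> 0 \<in> K \<and> 1 \<in> K \<and>
     (\<forall>x\<in>K. \<forall>y\<in>K. x + y \<in> K \<and> x * y \<in> K) \<and>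
     (\<forall>x\<in>K. - x \<in> K \<and> inverse x \<in> K)"

definition gen_field :: "complex set \<Rightarrow> complex set" where
  "gen_field S = \<Inter>{K. subfield K \<and> S \<subseteq> K}"

definition primitive_root :: "nat \<Rightarrow> complex \<Rightarrow> bool" where
  "primitive_root n z \<longleftrightarrow> z ^ n = 1 \<and> (\<forall>k. 0 < k \<and> k < n \<longrightarrow> z ^ k \<noteq> 1)"

definition degree_over_Q :: "complex set \<Rightarrow> nat \<Rightarrow> bool" where
  "degree_over_Q K d \<longleftrightarrow> (\<exists>B. finite B \<and> card B = d \<and> B \<subseteq> K \<and>
      (\<forall>c :: complex \<Rightarrow> rat. (\<Sum>b\<in>B. of_rat (c b) * b) = 0 \<longrightarrow> (\<forall>b\<in>B. c b = 0)) \<and>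
      (\<forall>x\<in>K. \<exists>c :: complex \<Rightarrow> rat. x = (\<Sum>b\<in>B. of_rat (c b) * b)))"

text \<open>Automorphisms of L fixing F pointwise (elements of Gal(L/F)); only values on L matter.\<close>
definition is_aut :: "complex set \<Rightarrow> complex set \<Rightarrow> (complex \<Rightarrow> complex) \<Rightarrow> bool" where
  "is_aut L F \<sigma> \<longleftrightarrow> bij_betw \<sigma> L L \<and>
     (\<forall>x\<in>L. \<forall>y\<in>L. \<sigma> (x + y) = \<sigma> x + \<sigma> y \<and> \<sigma> (x * y) = \<sigma> x * \<sigma> y) \<and>
     (\<forall>x\<in>F. \<sigma> x = x)"

definition gal_generator :: "complex set \<Rightarrow> complex set \<Rightarrow> (complex \<Rightarrow> complex) \<Rightarrow> bool" where
  "gal_generator K F \<tau> \<longleftrightarrow> is_aut K F \<tau> \<and>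
     (\<forall>\<sigma>. is_aut K F \<sigma> \<longrightarrow> (\<exists>k::nat. \<forall>x\<in>K. \<sigma> x = (\<tau> ^^ k) x))"

definition algebraic_integer :: "complex \<Rightarrow> bool" where
  "algebraic_integer x \<longleftrightarrow> (\<exists>P :: int poly. lead_coeff P = 1 \<and> poly (map_poly of_int P) x = 0)"

definition ring_of_integers :: "complex set \<Rightarrow> complex set" where
  "ring_of_integers K = {x \<in> K. algebraic_integer x}"

definition prime_ideal_of :: "complex set \<Rightarrow> complex set \<Rightarrow> bool" where
  "prime_ideal_of R P \<longleftrightarrow> P \<subseteq> R \<and> 0 \<in> P \<and> P \<noteq> R \<and>
     (\<forall>x\<in>P. \<forall>y\<in>P. x + y \<in> P) \<and> (\<forall>r\<in>R. \<forall>x\<in>P. r * x \<in> P) \<and>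
     (\<forall>x\<in>R. \<forall>y\<in>R. x * y \<in> P \<longrightarrow> x \<in> P \<or> y \<in> P)"

definition residue_card :: "complex set \<Rightarrow> complex set \<Rightarrow> nat" where
  "residue_card R P = card ((\<lambda>x. {y \<in> R. x - y \<in> P}) ` R)"

definition is_frobenius :: "complex set \<Rightarrow> complex set \<Rightarrow> complex set \<Rightarrow> (complex \<Rightarrow> complex) \<Rightarrow> bool" where
  "is_frobenius L F pp \<sigma> \<longleftrightarrow> is_aut L F \<sigma> \<and>
     (\<forall>Q. prime_ideal_of (ring_of_integers L) Q \<and> pp \<subseteq> Q \<longrightarrow>
        (\<forall>x\<in>ring_of_integers L. \<sigma> x - x ^ residue_card (ring_of_integers F) pp \<in> Q))"

definition is_frobenius_Q :: "complex set \<Rightarrow> nat \<Rightarrow> (complex \<Rightarrow> complex) \<Rightarrow> bool" where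
  "is_frobenius_Q K l \<sigma> \<longleftrightarrow> is_aut K \<rat> \<sigma> \<and>
     (\<forall>Q. prime_ideal_of (ring_of_integers K) Q \<and> of_nat l \<in> Q \<longrightarrow>
        (\<forall>x\<in>ring_of_integers K. \<sigma> x - x ^ l \<in> Q))"

end

theory Submission
  imports Defs "Jordan_Normal_Form.Char_Poly" "HOL-Number_Theory.Residue_Primitive_Roots"
begin

text \<open>
  Fix a primitive root g modulo p. Since p splits completely in F, reduction modulo \<open>\<wp>\<close> sends
  \<open>\<zeta>\<close> to a power \<open>c = g ^ (b (p - 1) / n)\<close> with b prime to n and the residue field has p elements.
  Applying the Frobenius congruence to \<open>l\<^sub>i ^ (1/n)\<close> gives
  \<open>c ^ a\<^sub>i \<equiv> l\<^sub>i ^ ((p - 1) / n)\<close> modulo p, that is, \<open>b a\<^sub>i \<equiv> d\<^sub>i\<close> modulo n where \<open>l\<^sub>i \<equiv> g ^ d\<^sub>i\<close>.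
  Let \<open>\<sigma>\<close> be the automorphism of the p-th cyclotomic field with \<open>\<zeta>\<^sub>p \<mapsto> \<zeta>\<^sub>p ^ g\<close>. Its restriction to K
  has order n, the Frobenius at \<open>l\<^sub>i\<close> is \<open>\<sigma> ^ d\<^sub>i\<close>, and hence \<open>\<tau> = \<sigma> ^ b\<close> does the job.

  Rings of integers are never computed. For \<open>z ^ N = 1\<close> and a prime q not dividing N, some iterate
  of the q-th power map is the identity on \<open>\<int>[z]/q\<close>, so \<open>\<int>[z]/q\<close> is reduced and every
  algebraic integer of \<open>\<rat>(z)\<close> lies in \<open>\<int>[z]\<close> up to a denominator prime to q.
\<close>

text \<open>Both sides see \<open>d\<^sub>i\<close> only modulo n: in the Kummer congruence because
  raising to the power (p - 1) / n forgets multiples of n in the exponent of g, in K because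
  \<sigma> restricted to K has order n. The unit b depends on the prime above p but not on i, so a
  single \<tau> serves all \<open>l\<^sub>i\<close>; b being prime to n makes \<tau> a generator.
  The two Frobenius conditions raise opposite obstacles. The hypothesis quantifies over the primes
  of L above \<open>pp\<close> and has content only once such a prime is exhibited, hence the
  explicit lying-over argument. The conclusion asks for a congruence for every integer of K modulo
  every prime containing \<open>l\<^sub>i\<close>, while the power map is controlled only on
  \<int>[\<open>\<zeta>\<^sub>p\<close>]; a denominator prime to \<open>l\<^sub>i\<close> lies
  outside the prime and can be cancelled. K is given only by its degree. It is identified with the
  field fixed by \<sigma> ^ n, by counting characters in one direction and periods in the
  other.\<close>

hide_const (open) up_ring.coeff up_ring.monom Module.smult

text \<open>Gaussian elimination: an unknown with nonzero coefficient in equation \<open>j\<close>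
  is eliminated together with that equation. All dimension counts rest on this, over \<rat> for
  vectors and over \<complex> for characters.\<close>

lemma homogeneous_system_nontrivial_solution:
  fixes A :: "'i \<Rightarrow> 'j \<Rightarrow> 'a::field"
  assumes "finite J" "finite I" "card J < card I"
  shows "\<exists>x. (\<exists>i\<in>I. x i \<noteq> 0) \<and> (\<forall>j\<in>J. (\<Sum>i\<in>I. x i * A i j) = 0)"
  using assms
proof (induction J arbitrary: I A rule: finite_induct)
  case empty
  then obtain i where "i \<in> I" by fastforce
  then show ?case by (intro exI[of _ "\<lambda>_. 1"]) auto
next
  case (insert j J)
  show ?case
  proof (cases "\<forall>i\<in>I. A i j = 0")
    case True
    have "card J < card I" using insert by simp
    from insert.IH[OF insert.prems(1) this, of A] True show ?thesis by auto
  next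
    case False
    then obtain k where k: "k \<in> I" "A k j \<noteq> 0" by auto
    define I' where "I' = I - {k}"
    have I': "I = insert k I'" "k \<notin> I'" "finite I'" using k insert.prems by (auto simp: I'_def)
    have "card J < card I'" using insert.prems insert.hyps I' by simp
    from insert.IH[OF I'(3) this, of "\<lambda>i m. A i m - A i j / A k j * A k m"] obtain x
      where x: "\<exists>i\<in>I'. x i \<noteq> 0"
        "\<forall>m\<in>J. (\<Sum>i\<in>I'. x i * (A i m - A i j / A k j * A k m)) = 0" by blast
    \<comment> \<open>The value at \<open>k\<close> is the one that equation \<open>j\<close>
      forces.\<close>
    define y where "y = x(k := - (\<Sum>i\<in>I'. x i * A i j) / A k j)"
    have y: "(\<Sum>i\<in>I. y i * A i m) = y k * A k m + (\<Sum>i\<in>I'. x i * A i m)" for m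
    proof -
      have "(\<Sum>i\<in>I'. y i * A i m) = (\<Sum>i\<in>I'. x i * A i m)"
        using I'(2) by (intro sum.cong) (auto simp: y_def)
      then show ?thesis using I' by simp
    qed
    have "(\<Sum>i\<in>I. y i * A i m) = 0" if "m \<in> insert j J" for m
    proof (cases "m = j")
      case True
      then show ?thesis using k by (simp add: y) (simp add: y_def)
    next
      case False
      with that x have "(\<Sum>i\<in>I'. x i * (A i m - A i j / A k j * A k m)) = 0" by auto
      also have "(\<Sum>i\<in>I'. x i * (A i m - A i j / A k j * A k m)) =
          (\<Sum>i\<in>I'. x i * A i m) - (\<Sum>i\<in>I'. x i * A i j) / A k j * A k m"
        by (simp add: right_diff_distrib sum_subtractf sum_distrib_right sum_divide_distrib mult.assoc)
      finally show ?thesis by (simp add: y) (simp add: y_def)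
    qed
    moreover have "\<exists>i\<in>I. y i \<noteq> 0" using x(1) I' by (auto simp: y_def)
    ultimately show ?thesis by blast
  qed
qed

section \<open>The ring of algebraic integers\<close>

text \<open>The subgroup generated by \<open>V\<close> when \<open>V\<close> is finite; for infinite
  \<open>V\<close> every such sum is 0 by convention.\<close>

definition int_span :: "complex set \<Rightarrow> complex set" where
  "int_span V = {\<Sum>v\<in>V. of_int (c v) * v | c. True}"

lemma int_span_add: "x \<in> int_span V \<Longrightarrow> y \<in> int_span V \<Longrightarrow> x + y \<in> int_span V"
  unfolding int_span_def
proof clarsimp
  fix c d :: "complex \<Rightarrow> int"
  show "\<exists>e. (\<Sum>v\<in>V. of_int (c v) * v) + (\<Sum>v\<in>V. of_int (d v) * v) = (\<Sum>v\<in>V. of_int (e v) * v)"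
    by (rule exI[of _ "\<lambda>v. c v + d v"]) (simp add: sum.distrib algebra_simps)
qed

lemma int_span_scale: "x \<in> int_span V \<Longrightarrow> of_int k * x \<in> int_span V"
  unfolding int_span_def
proof clarsimp
  fix c :: "complex \<Rightarrow> int"
  show "\<exists>e. of_int k * (\<Sum>v\<in>V. of_int (c v) * v) = (\<Sum>v\<in>V. of_int (e v) * v)"
    by (rule exI[of _ "\<lambda>v. k * c v"]) (simp add: sum_distrib_left algebra_simps)
qed

lemma int_span_0: "0 \<in> int_span V"
  unfolding int_span_def by (auto intro!: exI[of _ "\<lambda>_. 0"])

lemma int_span_sum: "(\<And>i. i \<in> I \<Longrightarrow> f i \<in> int_span V) \<Longrightarrow> (\<Sum>i\<in>I. f i) \<in> int_span V"
  by (induction I rule: infinite_finite_induct) (auto intro: int_span_0 int_span_add)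

lemma int_span_base: "finite V \<Longrightarrow> v \<in> V \<Longrightarrow> v \<in> int_span V"
  unfolding int_span_def
  by (auto intro!: exI[of _ "\<lambda>w. if w = v then 1 else 0"] simp: if_distrib if_distribR sum.delta cong: if_cong)

lemma int_span_mult_closed:
  assumes "\<And>v. v \<in> V \<Longrightarrow> x * v \<in> int_span V" "y \<in> int_span V"
  shows "x * y \<in> int_span V"
proof -
  from assms(2) obtain c where "y = (\<Sum>v\<in>V. of_int (c v) * v)" by (auto simp: int_span_def)
  then have "x * y = (\<Sum>v\<in>V. of_int (c v) * (x * v))" by (simp add: sum_distrib_left algebra_simps)
  then show ?thesis using assms(1) by (auto intro!: int_span_sum int_span_scale)
qed

text \<open>The determinant trick: multiplication by \<open>x\<close> is described by an integer
  matrix with eigenvalue \<open>x\<close>, so \<open>x\<close> is a root of its monic characteristic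
  polynomial. The nonzero \<open>w\<close> makes the vector listing \<open>V\<close> a genuine
  eigenvector.\<close>

lemma algebraic_integer_if_int_span_stable:
  assumes fin: "finite V" and nz: "w \<in> V" "w \<noteq> 0"
    and st: "\<And>v. v \<in> V \<Longrightarrow> x * v \<in> int_span V"
  shows "algebraic_integer x"
proof -
  obtain N f where f: "bij_betw f {0..<N::nat} V"
    using ex_bij_betw_nat_finite[OF fin] by blast
  have "\<exists>c. \<forall>v\<in>V. x * v = (\<Sum>u\<in>V. of_int (c v u) * u)"
    using st unfolding int_span_def by (auto intro!: bchoice)
  then obtain c where c: "\<And>v. v \<in> V \<Longrightarrow> x * v = (\<Sum>u\<in>V. of_int (c v u) * u)" by blast
  define A :: "int mat" where "A = mat N N (\<lambda>(i,j). c (f i) (f j))"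
  define A' :: "complex mat" where "A' = map_mat of_int A"
  define v where "v = vec N f"
  have A: "A \<in> carrier_mat N N" "A' \<in> carrier_mat N N" by (auto simp: A_def A'_def)
  have "A' *\<^sub>v v = x \<cdot>\<^sub>v v"
  proof (rule eq_vecI)
    fix i assume "i < dim_vec (x \<cdot>\<^sub>v v)"
    then have i: "i < N" by (simp add: v_def)
    then have "f i \<in> V" using f by (auto simp: bij_betw_def)
    have "(A' *\<^sub>v v) $ i = (\<Sum>j = 0..<N. of_int (c (f i) (f j)) * f j)"
      using i by (simp add: A'_def A_def v_def scalar_prod_def)
    also have "\<dots> = (\<Sum>u\<in>V. of_int (c (f i) u) * u)"
      by (rule sum.reindex_bij_betw[OF f])
    also have "\<dots> = x * f i" using c \<open>f i \<in> V\<close> by simp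
    finally show "(A' *\<^sub>v v) $ i = (x \<cdot>\<^sub>v v) $ i" using i by (simp add: v_def)
  qed (simp add: A'_def A_def v_def)
  moreover have "v \<noteq> 0\<^sub>v N"
  proof
    assume eq: "v = 0\<^sub>v N"
    obtain i where "i < N" "f i = w" using nz f by (force simp: bij_betw_def)
    then show False using eq nz by (metis index_vec index_zero_vec(1) v_def)
  qed
  ultimately have "eigenvector A' v x" using A by (simp add: eigenvector_def v_def)
  then have "eigenvalue A' x" by (auto simp: eigenvalue_def)
  then have "poly (char_poly A') x = 0" using eigenvalue_root_char_poly[OF A(2)] by simp
  moreover have "char_poly A' = map_poly of_int (char_poly A)"
    unfolding A'_def by (rule of_int_hom.char_poly_hom[OF A(1)])
  moreover have "monic (char_poly A)" using degree_monic_char_poly[OF A(1)] by simp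
  ultimately show ?thesis unfolding algebraic_integer_def by auto
qed

text \<open>The monic equation solved for its leading power. A monic constant has no root, which
  gives \<open>d > 0\<close>.\<close>

lemma algebraic_integer_power_reduce:
  assumes "algebraic_integer x"
  shows "\<exists>d>0. \<exists>c :: nat \<Rightarrow> int. x ^ d = (\<Sum>i<d. of_int (c i) * x ^ i)"
proof -
  from assms obtain P :: "int poly" where P: "lead_coeff P = 1" "poly (map_poly of_int P) x = 0"
    by (auto simp: algebraic_integer_def)
  define d where "d = degree P"
  have "0 = (\<Sum>i\<le>d. of_int (coeff P i) * x ^ i)"
    using P(2) by (simp add: poly_altdef d_def)
  also have "\<dots> = x ^ d + (\<Sum>i<d. of_int (coeff P i) * x ^ i)"
  proof -
    have "{..d} = insert d {..<d}" by auto
    then show ?thesis using P(1) by (simp add: d_def)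
  qed
  finally have "x ^ d = - (\<Sum>i<d. of_int (coeff P i) * x ^ i)"
    by (metis eq_neg_iff_add_eq_0)
  then have eq: "x ^ d = (\<Sum>i<d. of_int (- coeff P i) * x ^ i)"
    by (simp only: of_int_minus mult_minus_left sum_negf)
  have "d > 0"
  proof (rule ccontr)
    assume "\<not> d > 0" then have "d = 0" by simp
    with eq show False by simp
  qed
  show ?thesis
    by (rule exI[of _ d], rule conjI[OF \<open>d > 0\<close>], rule exI[of _ "\<lambda>i. - coeff P i"], rule eq)
qed

text \<open>The monomials \<open>x ^ i * y ^ j\<close> with \<open>i < d\<close> and
  \<open>j < e\<close> span a group stable under multiplication by both \<open>x\<close> and
  \<open>y\<close>; the two integral equations enter only when an exponent reaches its bound.
  Stability under the sum and the product follows.\<close>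

lemma algebraic_integer_add_mult:
  assumes "algebraic_integer x" "algebraic_integer y"
  shows "algebraic_integer (x + y) \<and> algebraic_integer (x * y)"
proof -
  obtain d c where d: "d > 0" "x ^ d = (\<Sum>i<d. of_int (c i) * x ^ i)"
    using algebraic_integer_power_reduce[OF assms(1)] by blast
  obtain e b where e: "e > 0" "y ^ e = (\<Sum>i<e. of_int (b i) * y ^ i)"
    using algebraic_integer_power_reduce[OF assms(2)] by blast
  define V where "V = (\<lambda>(i,j). x ^ i * y ^ j) ` ({..<d} \<times> {..<e})"
  have fin: "finite V" by (simp add: V_def)
  have V: "x ^ i * y ^ j \<in> int_span V" if "i < d" "j < e" for i j
    by (rule int_span_base[OF fin]) (use that in \<open>auto simp: V_def\<close>)
  have one: "1 \<in> V" using d e by (auto simp: V_def intro!: image_eqI[of _ _ "(0,0)"])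
  have x: "x * v \<in> int_span V" if "v \<in> V" for v
  proof -
    from that obtain i j where ij: "v = x ^ i * y ^ j" "i < d" "j < e" by (auto simp: V_def)
    show ?thesis
    proof (cases "Suc i < d")
      case True
      with V[of "Suc i" j] ij show ?thesis by (simp add: mult.assoc)
    next
      case False
      with ij have "Suc i = d" by simp
      then have "x * v = x ^ d * y ^ j" by (simp add: ij flip: mult.assoc power_Suc)
      also have "\<dots> = (\<Sum>k<d. of_int (c k) * (x ^ k * y ^ j))"
        unfolding d by (simp add: sum_distrib_right mult.assoc)
      also have "\<dots> \<in> int_span V" using V ij by (auto intro!: int_span_sum int_span_scale)
      finally show ?thesis .
    qed
  qed
  have y: "y * v \<in> int_span V" if "v \<in> V" for v
  proof -
    from that obtain i j where ij: "v = x ^ i * y ^ j" "i < d" "j < e" by (auto simp: V_def)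
    show ?thesis
    proof (cases "Suc j < e")
      case True
      with V[of i "Suc j"] ij show ?thesis by (simp add: ac_simps)
    next
      case False
      with ij have "Suc j = e" by simp
      then have "y * v = x ^ i * y ^ e" using ij by (metis mult.left_commute power_Suc)
      also have "\<dots> = (\<Sum>k<e. of_int (b k) * (x ^ i * y ^ k))"
        unfolding e by (simp add: sum_distrib_left mult.left_commute)
      also have "\<dots> \<in> int_span V" using V ij by (auto intro!: int_span_sum int_span_scale)
      finally show ?thesis .
    qed
  qed
  have "(x + y) * v \<in> int_span V" if "v \<in> V" for v
    using x[OF that] y[OF that] by (simp add: distrib_right int_span_add)
  moreover have "(x * y) * v \<in> int_span V" if "v \<in> V" for v
    using int_span_mult_closed[OF x y[OF that]] by (simp add: mult.assoc)
  ultimately show ?thesis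
    using algebraic_integer_if_int_span_stable[OF fin one] by simp
qed

lemma algebraic_integer_add: "algebraic_integer x \<Longrightarrow> algebraic_integer y \<Longrightarrow> algebraic_integer (x + y)"
  and algebraic_integer_mult: "algebraic_integer x \<Longrightarrow> algebraic_integer y \<Longrightarrow> algebraic_integer (x * y)"
  using algebraic_integer_add_mult by blast+

lemma algebraic_integer_of_int: "algebraic_integer (of_int k)"
  unfolding algebraic_integer_def by (rule exI[of _ "[:- k, 1:]"]) simp

lemma algebraic_integer_of_nat: "algebraic_integer (of_nat k)"
  using algebraic_integer_of_int[of "int k"] by simp

lemma algebraic_integer_uminus: "algebraic_integer x \<Longrightarrow> algebraic_integer (- x)"
  using algebraic_integer_mult[OF algebraic_integer_of_int[of "-1"]] by simp

lemma algebraic_integer_root_of_int: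
  assumes "x ^ n = of_int k" "n > 0"
  shows "algebraic_integer x"
proof -
  let ?P = "monom 1 n + [:- k:] :: int poly"
  have "degree ?P = n" using assms by (subst degree_add_eq_left) (auto simp: degree_monom_eq)
  then have "lead_coeff ?P = 1" using assms by (simp add: coeff_pCons split: nat.split)
  moreover have "poly (map_poly of_int ?P) x = 0"
    using assms by (simp add: of_int_hom.map_poly_hom_add map_poly_monom poly_monom of_int_hom.map_poly_pCons_hom)
  ultimately show ?thesis unfolding algebraic_integer_def by blast
qed

lemma algebraic_integer_rational:
  assumes "algebraic_integer x" "x \<in> \<rat>"
  shows "x \<in> \<int>"
proof -
  have "algebraic_int x"
    using assms(1) unfolding algebraic_integer_def algebraic_int_altdef_ipoly by blast
  then show ?thesis using assms(2) by (rule rational_algebraic_int_is_int)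
qed

section \<open>Congruences in rings generated by roots of unity\<close>

definition is_subring :: "complex set \<Rightarrow> bool" where
  "is_subring A \<longleftrightarrow> 1 \<in> A \<and> (\<forall>x\<in>A. \<forall>y\<in>A. x - y \<in> A \<and> x * y \<in> A)"

lemma is_subringI:
  assumes "1 \<in> A" "\<And>x y. x \<in> A \<Longrightarrow> y \<in> A \<Longrightarrow> x - y \<in> A"
    "\<And>x y. x \<in> A \<Longrightarrow> y \<in> A \<Longrightarrow> x * y \<in> A"
  shows "is_subring A"
  using assms by (auto simp: is_subring_def)

context
  fixes A assumes A: "is_subring A"
begin

lemma subring_1: "1 \<in> A" using A by (simp add: is_subring_def)
lemma subring_diff: "x \<in> A \<Longrightarrow> y \<in> A \<Longrightarrow> x - y \<in> A" using A by (simp add: is_subring_def)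
lemma subring_mult: "x \<in> A \<Longrightarrow> y \<in> A \<Longrightarrow> x * y \<in> A" using A by (simp add: is_subring_def)
lemma subring_0: "0 \<in> A" using subring_diff[OF subring_1 subring_1] by simp
lemma subring_uminus: "x \<in> A \<Longrightarrow> - x \<in> A" using subring_diff[OF subring_0, of x] by simp
lemma subring_add: "x \<in> A \<Longrightarrow> y \<in> A \<Longrightarrow> x + y \<in> A"
  using subring_diff[OF _ subring_uminus, of x y] by simp
lemma subring_power: "x \<in> A \<Longrightarrow> x ^ k \<in> A"
  by (induction k) (auto intro: subring_1 subring_mult)
lemma subring_of_nat: "of_nat k \<in> A"
  by (induction k) (auto intro: subring_0 subring_1 subring_add)
lemma subring_of_int: "of_int k \<in> A"
  by (cases k rule: int_diff_cases) (auto intro: subring_diff subring_of_nat)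
lemma subring_sum: "(\<And>i. i \<in> I \<Longrightarrow> f i \<in> A) \<Longrightarrow> (\<Sum>i\<in>I. f i) \<in> A"
  by (induction I rule: infinite_finite_induct) (auto intro: subring_0 subring_add)
lemma subring_poly: "z \<in> A \<Longrightarrow> poly (map_poly of_int h) z \<in> A"
  by (simp add: poly_altdef subring_sum subring_mult subring_power subring_of_int)

lemmas subring_closed = subring_0 subring_1 subring_diff subring_mult subring_uminus subring_add
  subring_power subring_of_nat subring_of_int subring_sum subring_poly

end

definition cong_mod :: "complex set \<Rightarrow> complex \<Rightarrow> complex \<Rightarrow> complex \<Rightarrow> bool" where
  "cong_mod A q x y \<longleftrightarrow> (\<exists>w\<in>A. x - y = q * w)"

context
  fixes A assumes A: "is_subring A"
begin

lemma cong_mod_refl: "cong_mod A q x x"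
  using subring_0[OF A] by (auto simp: cong_mod_def intro!: bexI[of _ 0])

lemma cong_mod_trans: "cong_mod A q x y \<Longrightarrow> cong_mod A q y z \<Longrightarrow> cong_mod A q x z"
  unfolding cong_mod_def
proof (elim bexE)
  fix v w assume "v \<in> A" "w \<in> A" "x - y = q * v" "y - z = q * w"
  then show "\<exists>w\<in>A. x - z = q * w"
    by (intro bexI[of _ "v + w"] subring_add[OF A]) (auto simp: algebra_simps)
qed

lemma cong_mod_add: "cong_mod A q x y \<Longrightarrow> cong_mod A q x' y' \<Longrightarrow> cong_mod A q (x + x') (y + y')"
  unfolding cong_mod_def
proof (elim bexE)
  fix v w assume "v \<in> A" "w \<in> A" "x - y = q * v" "x' - y' = q * w"
  then show "\<exists>w\<in>A. x + x' - (y + y') = q * w"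
    by (intro bexI[of _ "v + w"] subring_add[OF A]) (auto simp: algebra_simps)
qed

lemma cong_mod_mult:
  assumes "x \<in> A" "y' \<in> A" "cong_mod A q x y" "cong_mod A q x' y'"
  shows "cong_mod A q (x * x') (y * y')"
proof -
  from assms obtain v w where vw: "v \<in> A" "w \<in> A" "x - y = q * v" "x' - y' = q * w"
    by (auto simp: cong_mod_def)
  have "x * x' - y * y' = x * (x' - y') + (x - y) * y'" by (simp add: algebra_simps)
  also have "\<dots> = q * (x * w + v * y')" by (simp add: vw algebra_simps)
  finally show ?thesis using vw assms
    unfolding cong_mod_def by (intro bexI[of _ "x * w + v * y'"]) (auto intro!: subring_closed[OF A])
qed

lemma cong_mod_power:
  assumes "x \<in> A" "y \<in> A" "cong_mod A q x y"
  shows "cong_mod A q (x ^ k) (y ^ k)"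
  using assms by (induction k) (auto intro!: cong_mod_refl cong_mod_mult subring_power[OF A])

lemma cong_mod_int:
  assumes "int m dvd a - b"
  shows "cong_mod A (of_nat m) (of_int a) (of_int b)"
proof -
  from assms obtain k where "a - b = int m * k" by (auto elim: dvdE)
  then have "complex_of_int a - of_int b = of_nat m * of_int k" by (metis of_int_diff of_int_mult of_int_of_nat_eq)
  then show ?thesis unfolding cong_mod_def using subring_of_int[OF A] by blast
qed

text \<open>The inner binomial coefficients of the q-th row are divisible by q.\<close>

lemma cong_mod_power_prime_add:
  assumes q: "prime q" and xy: "x \<in> A" "y \<in> A"
  shows "cong_mod A (of_nat q) ((x + y) ^ q) (x ^ q + y ^ q)"
proof -
  have q0: "q > 0" using q prime_gt_0_nat by blast
  have "{..q} = insert 0 (insert q {0<..<q})" using q0 by auto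
  then have "(x + y) ^ q = x ^ q + y ^ q + (\<Sum>k\<in>{0<..<q}. of_nat (q choose k) * x ^ k * y ^ (q - k))"
    unfolding binomial_ring using q0 by simp
  also have "(\<Sum>k\<in>{0<..<q}. of_nat (q choose k) * x ^ k * y ^ (q - k)) =
      (\<Sum>k\<in>{0<..<q}. of_nat q * (of_nat ((q choose k) div q) * x ^ k * y ^ (q - k)))"
  proof (rule sum.cong)
    fix k assume "k \<in> {0<..<q}"
    then have "q dvd (q choose k)" using q by (intro dvd_choose_prime) auto
    then have "q choose k = q * ((q choose k) div q)" by simp
    then have "complex_of_nat (q choose k) = of_nat q * of_nat ((q choose k) div q)"
      by (metis of_nat_mult)
    then show "of_nat (q choose k) * x ^ k * y ^ (q - k) =
        of_nat q * (of_nat ((q choose k) div q) * x ^ k * y ^ (q - k))" by simp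
  qed simp
  finally show ?thesis unfolding cong_mod_def
    by (intro bexI[of _ "\<Sum>k\<in>{0<..<q}. of_nat ((q choose k) div q) * x ^ k * y ^ (q - k)"])
       (auto simp: sum_distrib_left intro!: subring_closed[OF A] xy)
qed

end

lemma prime_dvd_power_diff_self:
  assumes "prime q"
  shows "int q dvd a ^ q - a"
proof -
  define b where "b = nat (a mod int q)"
  have q0: "q > 0" using assms prime_gt_0_nat by blast
  have "[b ^ q = b] (mod q)"
  proof (cases "q dvd b")
    case True
    then show ?thesis using q0 by (metis cong_0_iff cong_sym cong_trans dvd_power dvd_trans)
  next
    case False
    then have "[b ^ (q - 1) * b = 1 * b] (mod q)"
      using fermat_theorem[OF assms] by (intro cong_mult) auto
    then show ?thesis using q0 by (metis Suc_diff_1 mult_1 power_Suc2)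
  qed
  then have "[int b ^ q = int b] (mod int q)" by (metis cong_int_iff of_nat_power)
  moreover have "[a = int b] (mod int q)" using q0 by (simp add: b_def cong_def)
  ultimately have "[a ^ q = a] (mod int q)" by (meson cong_pow cong_sym cong_trans)
  then show ?thesis by (simp add: cong_iff_dvd_diff)
qed

text \<open>Modulo q the q-th power map respects sums and products and fixes integers, so on
  polynomial expressions in \<open>z\<close> it only replaces \<open>z\<close> by
  \<open>z ^ q\<close>. The induction follows Horner's scheme.\<close>

lemma cong_mod_frobenius:
  assumes A: "is_subring A" and q: "prime q" and z: "z \<in> A"
  shows "cong_mod A (of_nat q) (poly (map_poly of_int h) z ^ q) (poly (map_poly of_int h) (z ^ q))"
proof (induction h)
  case 0
  then show ?case using prime_gt_0_nat[OF q] by (simp add: zero_power cong_mod_refl[OF A])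
next
  case (pCons a h)
  let ?h = "poly (map_poly of_int h)"
  note cl = subring_closed[OF A] z
  have "cong_mod A (of_nat q) ((of_int a + z * ?h z) ^ q) (of_int a ^ q + (z * ?h z) ^ q)"
    by (rule cong_mod_power_prime_add[OF A q]) (auto intro!: cl)
  moreover have "cong_mod A (of_nat q) (of_int a ^ q + (z * ?h z) ^ q) (of_int a + z ^ q * ?h (z ^ q))"
  proof (rule cong_mod_add[OF A])
    show "cong_mod A (of_nat q) (of_int a ^ q) (of_int a)"
      using cong_mod_int[OF A prime_dvd_power_diff_self[OF q, of a]] by simp
    show "cong_mod A (of_nat q) ((z * ?h z) ^ q) (z ^ q * ?h (z ^ q))"
      unfolding power_mult_distrib using pCons.IH
      by (intro cong_mod_mult[OF A] cong_mod_refl[OF A]) (auto intro!: cl)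
  qed
  ultimately show ?case
    using cong_mod_trans[OF A] by (simp add: of_int_hom.map_poly_pCons_hom)
qed

lemma cong_mod_frobenius_iter:
  assumes A: "is_subring A" and q: "prime q" and z: "z \<in> A"
  shows "cong_mod A (of_nat q) (poly (map_poly of_int h) z ^ (q ^ f)) (poly (map_poly of_int h) (z ^ (q ^ f)))"
proof (induction f)
  case 0
  then show ?case by (simp add: cong_mod_refl[OF A])
next
  case (Suc f)
  let ?h = "poly (map_poly of_int h)"
  note cl = subring_closed[OF A] z
  have "cong_mod A (of_nat q) ((?h z ^ (q ^ f)) ^ q) (?h (z ^ (q ^ f)) ^ q)"
    by (rule cong_mod_power[OF A _ _ Suc.IH]) (auto intro!: cl)
  moreover have "cong_mod A (of_nat q) (?h (z ^ (q ^ f)) ^ q) (?h ((z ^ (q ^ f)) ^ q))"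
    by (rule cong_mod_frobenius[OF A q]) (auto intro!: cl)
  ultimately have "cong_mod A (of_nat q) ((?h z ^ (q ^ f)) ^ q) (?h ((z ^ (q ^ f)) ^ q))"
    by (rule cong_mod_trans[OF A])
  then show ?case by (simp only: power_mult[symmetric] power_Suc2)
qed

section \<open>The rings \<int>[z] and \<rat>[z] and denominators of algebraic integers\<close>

definition int_adjoin :: "complex \<Rightarrow> complex set" where
  "int_adjoin z = range (\<lambda>h. poly (map_poly of_int h) z)"

definition rat_adjoin :: "complex \<Rightarrow> complex set" where
  "rat_adjoin z = range (\<lambda>h. poly (map_poly of_rat h) z)"

lemma is_subring_int_adjoin: "is_subring (int_adjoin z)"
proof (rule is_subringI)
  show "1 \<in> int_adjoin z" unfolding int_adjoin_def by (rule range_eqI[of _ _ 1]) simp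
next
  fix x y assume "x \<in> int_adjoin z" "y \<in> int_adjoin z"
  then obtain f g where fg: "x = poly (map_poly of_int f) z" "y = poly (map_poly of_int g) z"
    by (auto simp: int_adjoin_def)
  show "x - y \<in> int_adjoin z"
    unfolding int_adjoin_def by (rule range_eqI[of _ _ "f - g"]) (simp add: fg hom_distribs)
  show "x * y \<in> int_adjoin z"
    unfolding int_adjoin_def by (rule range_eqI[of _ _ "f * g"]) (simp add: fg hom_distribs)
qed

interpretation of_rat_poly_hom: map_poly_comm_ring_hom "of_rat :: rat \<Rightarrow> complex" ..

lemma is_subring_rat_adjoin: "is_subring (rat_adjoin z)"
proof (rule is_subringI)
  show "1 \<in> rat_adjoin z" unfolding rat_adjoin_def by (rule range_eqI[of _ _ 1]) simp
next
  fix x y assume "x \<in> rat_adjoin z" "y \<in> rat_adjoin z"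
  then obtain f g where fg: "x = poly (map_poly of_rat f) z" "y = poly (map_poly of_rat g) z"
    by (auto simp: rat_adjoin_def)
  show "x - y \<in> rat_adjoin z"
    unfolding rat_adjoin_def
    by (rule range_eqI[of _ _ "f - g"]) (simp add: fg of_rat_poly_hom.hom_minus)
  show "x * y \<in> rat_adjoin z"
    unfolding rat_adjoin_def
    by (rule range_eqI[of _ _ "f * g"]) (simp add: fg of_rat_poly_hom.hom_mult)
qed

lemma generator_in_int_adjoin: "z \<in> int_adjoin z"
  unfolding int_adjoin_def by (rule range_eqI[of _ _ "[:0, 1:]"]) (simp add: of_int_hom.map_poly_pCons_hom)

lemma generator_in_rat_adjoin: "z \<in> rat_adjoin z"
  unfolding rat_adjoin_def by (rule range_eqI[of _ _ "[:0, 1:]"]) (simp add: of_rat_hom.map_poly_pCons_hom)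

lemma of_rat_in_rat_adjoin: "of_rat c \<in> rat_adjoin z"
  unfolding rat_adjoin_def by (rule range_eqI[of _ _ "[:c:]"]) (simp add: of_rat_hom.map_poly_pCons_hom)

lemma rat_poly_common_denominator: "\<exists>d>0. \<exists>g :: int poly. smult (of_nat d) h = map_poly of_int (g :: int poly)"
  for h :: "rat poly"
proof (induction h)
  case 0
  show ?case by (rule exI[of _ 1], rule conjI, simp, rule exI[of _ 0]) simp
next
  case (pCons a h)
  then obtain d g where d: "d > 0" "smult (of_nat d) h = map_poly of_int (g :: int poly)" by blast
  obtain u v where uv: "quotient_of a = (u, v)" by fastforce
  then have v: "v > 0" "a = of_int u / of_int v"
    using quotient_of_denom_pos quotient_of_div by blast+
  define w where "w = nat v"
  have w: "w > 0" "a = of_int u / of_nat w" using v by (auto simp: w_def)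
  have "smult (of_nat (d * w)) (pCons a h) = pCons (of_nat d * of_int u) (smult (of_nat w) (smult (of_nat d) h))"
    using w by (simp add: mult.commute)
  also have "\<dots> = map_poly of_int (pCons (int d * u) (smult (int w) g))"
    unfolding d(2) by (simp add: of_int_hom.map_poly_pCons_hom hom_distribs)
  finally show ?case using d(1) w(1)
    by (intro exI[of _ "d * w"] conjI exI[of _ "pCons (int d * u) (smult (int w) g)"]) auto
qed

lemma rat_adjoin_common_denominator:
  assumes "x \<in> rat_adjoin z"
  shows "\<exists>d>0. of_nat d * x \<in> int_adjoin z"
proof -
  from assms obtain h where h: "x = poly (map_poly of_rat h) z" by (auto simp: rat_adjoin_def)
  obtain d g where d: "d > 0" "smult (of_nat d) h = map_poly of_int (g :: int poly)"
    using rat_poly_common_denominator by blast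
  have "of_nat d * x = poly (map_poly of_rat (smult (of_nat d) h)) z"
    by (simp add: h hom_distribs)
  also have "\<dots> = poly (map_poly of_int g) z"
    unfolding d(2) by (simp add: map_poly_map_poly o_def)
  finally show ?thesis using d(1) by (auto simp: int_adjoin_def)
qed

lemma power_mod_root_of_unity:
  fixes z :: complex
  assumes "z ^ N = 1" "[a = b] (mod N)"
  shows "z ^ a = z ^ b"
proof -
  have "z ^ k = z ^ (k mod N)" for k
  proof -
    have "z ^ k = z ^ (N * (k div N) + k mod N)" by simp
    also have "\<dots> = z ^ (k mod N)" unfolding power_add power_mult using assms by simp
    finally show ?thesis .
  qed
  then show ?thesis using assms(2) by (metis cong_def)
qed

text \<open>With \<open>f = totient N\<close>, Euler's theorem gives \<open>z ^ (q ^ f) = z\<close>,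
  so the power map with exponent \<open>q ^ f\<close> is the identity on \<int>[z] modulo q. For
  \<open>y = q u\<close> the integral equation of \<open>u\<close> shows that q divides a power of
  \<open>y\<close>; a higher power is congruent to \<open>y\<close> itself, so q divides
  \<open>y\<close> in \<int>[z].\<close>

lemma int_adjoin_root_of_unity_divide_prime:
  assumes z: "z ^ N = 1" and q: "prime q" "coprime q N"
    and u: "algebraic_integer u" "of_nat q * u \<in> int_adjoin z"
  shows "u \<in> int_adjoin z"
proof -
  let ?A = "int_adjoin z"
  note A = is_subring_int_adjoin[of z]
  define y where "y = of_nat q * u"
  define f where "f = totient N"
  have q2: "q \<ge> 2" using q prime_ge_2_nat by blast
  then have N0: "N > 0" using q by (cases "N = 0") auto
  have "[q ^ f = 1] (mod N)" using q(2) unfolding f_def by (rule euler_theorem)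
  then have zf: "z ^ (q ^ f) = z" using power_mod_root_of_unity[OF z] by (metis power_one_right)
  have f0: "f > 0" using N0 by (simp add: f_def)
  have fix_pow: "cong_mod ?A (of_nat q) (x ^ (q ^ f)) x" if "x \<in> ?A" for x
  proof -
    from that obtain h where h: "x = poly (map_poly of_int h) z" by (auto simp: int_adjoin_def)
    show ?thesis
      using cong_mod_frobenius_iter[OF A q(1) generator_in_int_adjoin, of h f] by (simp add: h zf)
  qed
  have yA: "y \<in> ?A" using u by (simp add: y_def)
  have iter: "cong_mod ?A (of_nat q) (y ^ ((q ^ f) ^ k)) y" for k
  proof (induction k)
    case (Suc k)
    have "cong_mod ?A (of_nat q) ((y ^ ((q ^ f) ^ k)) ^ (q ^ f)) (y ^ (q ^ f))"
      by (rule cong_mod_power[OF A _ _ Suc.IH]) (auto intro!: subring_power[OF A] yA)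
    with fix_pow[OF yA] have "cong_mod ?A (of_nat q) ((y ^ ((q ^ f) ^ k)) ^ (q ^ f)) y"
      using cong_mod_trans[OF A] by blast
    then show ?case by (simp only: power_mult[symmetric] power_Suc2)
  qed (simp add: cong_mod_refl[OF A])
  obtain d c where d: "d > 0" "u ^ d = (\<Sum>i<d. of_int (c i) * u ^ i)"
    using algebraic_integer_power_reduce[OF u(1)] by blast
  have "y ^ d = (\<Sum>i<d. of_nat q ^ d * (of_int (c i) * u ^ i))"
    unfolding y_def power_mult_distrib d(2) by (simp add: sum_distrib_left)
  \<comment> \<open>Of the d factors q only i are absorbed into \<open>y ^ i\<close>; since
    \<open>i < d\<close>, at least one is left over.\<close>
  also have "\<dots> = (\<Sum>i<d. of_nat q * (of_nat q ^ (d - 1 - i) * of_int (c i) * y ^ i))"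
  proof (rule sum.cong)
    fix i assume "i \<in> {..<d}"
    then have "d = Suc (d - 1 - i) + i" by auto
    then have "(of_nat q :: complex) ^ d = of_nat q * of_nat q ^ (d - 1 - i) * of_nat q ^ i"
      by (metis power_Suc power_add)
    then show "of_nat q ^ d * (of_int (c i) * u ^ i) =
        of_nat q * (of_nat q ^ (d - 1 - i) * of_int (c i) * y ^ i)"
      by (simp add: y_def power_mult_distrib)
  qed simp
  also have "\<dots> = of_nat q * (\<Sum>i<d. of_nat q ^ (d - 1 - i) * of_int (c i) * y ^ i)"
    by (simp add: sum_distrib_left)
  finally have w': "y ^ d = of_nat q * (\<Sum>i<d. of_nat q ^ (d - 1 - i) * of_int (c i) * y ^ i)" .
  define w where "w = (\<Sum>i<d. of_nat q ^ (d - 1 - i) * of_int (c i) * y ^ i)"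
  have w: "w \<in> ?A" "y ^ d = of_nat q * w"
    using w' by (auto simp: w_def intro!: subring_closed[OF A] yA)
  \<comment> \<open>Iterating d times suffices, since the exponent \<open>(q ^ f) ^ d\<close> is at
    least \<open>2 ^ d\<close> and so exceeds d.\<close>
  have "q ^ f \<ge> 2" using q2 f0 power_increasing[of 1 f q] by simp
  then have "(q ^ f) ^ d \<ge> 2 ^ d" by (rule power_mono) simp
  then have "d \<le> (q ^ f) ^ d" by (meson less_exp order.strict_implies_order le_trans)
  then have "y ^ ((q ^ f) ^ d) = y ^ d * y ^ ((q ^ f) ^ d - d)" by (simp flip: power_add)
  then have "y ^ ((q ^ f) ^ d) = of_nat q * (w * y ^ ((q ^ f) ^ d - d))" by (simp add: w)
  moreover obtain v where v: "v \<in> ?A" "y ^ ((q ^ f) ^ d) - y = of_nat q * v"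
    using iter[of d] by (auto simp: cong_mod_def)
  ultimately have "of_nat q * u = of_nat q * (w * y ^ ((q ^ f) ^ d - d) - v)"
    by (simp add: y_def algebra_simps)
  then have "u = w * y ^ ((q ^ f) ^ d - d) - v" using q2 by simp
  then show ?thesis using subring_closed[OF A] yA v w by simp
qed

text \<open>Starting from any denominator, factors q are cancelled one at a time by the preceding
  lemma.\<close>

lemma algebraic_integer_denominator_coprime:
  assumes z: "z ^ N = 1" and q: "prime q" "coprime q N"
    and u: "algebraic_integer u" "u \<in> rat_adjoin z"
  shows "\<exists>m. coprime m q \<and> of_nat m * u \<in> int_adjoin z"
proof -
  obtain d where d: "d > 0" "of_nat d * u \<in> int_adjoin z"
    using rat_adjoin_common_denominator[OF u(2)] by blast
  from d show ?thesis
  proof (induction d rule: less_induct)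
    case (less d)
    show ?case
    proof (cases "q dvd d")
      case True
      then obtain e where e: "d = q * e" by blast
      have "e < d" "e > 0" using e less.prems prime_gt_1_nat[OF q(1)] by auto
      moreover have "of_nat e * u \<in> int_adjoin z"
        by (rule int_adjoin_root_of_unity_divide_prime[OF z q])
           (use less.prems u e in \<open>auto simp: mult.assoc intro: algebraic_integer_mult algebraic_integer_of_nat\<close>)
      ultimately show ?thesis using less.IH by blast
    next
      case False
      then have "coprime d q" using q by (metis coprime_commute prime_imp_coprime)
      then show ?thesis using less.prems by blast
    qed
  qed
qed

section \<open>Subfields and prime ideals\<close>

text \<open>The vectors form an indexed family, so that coinciding vectors, such as equal powers of
  one element, still count separately.\<close>

lemma rat_span_dependent:
  fixes v :: "'i \<Rightarrow> complex"
  assumes "finite I" "finite J" "card J < card I"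
    and v: "\<And>i. i \<in> I \<Longrightarrow> v i = (\<Sum>j\<in>J. of_rat (A i j) * w j)"
  shows "\<exists>x. (\<exists>i\<in>I. x i \<noteq> 0) \<and> (\<Sum>i\<in>I. of_rat (x i) * v i) = 0"
proof -
  obtain x where x: "\<exists>i\<in>I. x i \<noteq> 0" "\<And>j. j \<in> J \<Longrightarrow> (\<Sum>i\<in>I. x i * A i j) = 0"
    using homogeneous_system_nontrivial_solution[OF assms(2,1,3), of A] by blast
  have "(\<Sum>i\<in>I. of_rat (x i) * v i) = (\<Sum>i\<in>I. \<Sum>j\<in>J. of_rat (x i) * (of_rat (A i j) * w j))"
    using v by (simp add: sum_distrib_left)
  also have "\<dots> = (\<Sum>j\<in>J. \<Sum>i\<in>I. of_rat (x i) * (of_rat (A i j) * w j))" by (rule sum.swap)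
  also have "\<dots> = (\<Sum>j\<in>J. of_rat (\<Sum>i\<in>I. x i * A i j) * w j)"
    by (simp add: of_rat_sum of_rat_mult sum_distrib_right mult.assoc)
  also have "\<dots> = 0" using x(2) by simp
  finally show ?thesis using x(1) by blast
qed

lemma rat_adjoin_root_of_unity_span:
  assumes z: "z ^ N = 1" "N > 0" and x: "x \<in> rat_adjoin z"
  shows "\<exists>c. x = (\<Sum>k<N. of_rat (c k) * z ^ k)"
proof -
  from x obtain h where h: "x = poly (map_poly of_rat h) z" by (auto simp: rat_adjoin_def)
  obtain M where M: "N = Suc M" using z(2) by (cases N) auto
  have "\<exists>c. poly (map_poly of_rat h) z = (\<Sum>k<N. of_rat (c k) * z ^ k)"
  proof (induction h)
    case 0
    show ?case by (rule exI[of _ "\<lambda>_. 0"]) simp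
  next
    case (pCons a h)
    then obtain c where c: "poly (map_poly of_rat h) z = (\<Sum>k<N. of_rat (c k) * z ^ k)" by blast
    have "poly (map_poly of_rat (pCons a h)) z = of_rat a + z * (\<Sum>k<N. of_rat (c k) * z ^ k)"
      by (simp add: of_rat_hom.map_poly_pCons_hom c)
    \<comment> \<open>The top term wraps around by \<open>z ^ N = 1\<close> and joins the constant
      term.\<close>
    also have "z * (\<Sum>k<N. of_rat (c k) * z ^ k) = (\<Sum>k<M. of_rat (c k) * z ^ Suc k) + of_rat (c M)"
      using z(1) unfolding M by (simp add: sum_distrib_left distrib_left mult.left_commute)
    also have "of_rat a + ((\<Sum>k<M. of_rat (c k) * z ^ Suc k) + of_rat (c M)) =
        (\<Sum>k<N. of_rat (case k of 0 \<Rightarrow> a + c M | Suc j \<Rightarrow> c j) * z ^ k)"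
      unfolding M sum.lessThan_Suc_shift by (simp add: of_rat_add)
    finally show ?case by (rule exI[of _ "\<lambda>k. case k of 0 \<Rightarrow> a + c M | Suc j \<Rightarrow> c j"])
  qed
  then show ?thesis by (simp add: h)
qed

lemma subfield_is_subring: "subfield K \<Longrightarrow> is_subring K"
  unfolding subfield_def by (intro is_subringI) (auto simp only: diff_conv_add_uminus)

lemma subfield_divide: "subfield K \<Longrightarrow> x \<in> K \<Longrightarrow> y \<in> K \<Longrightarrow> x / y \<in> K"
  by (simp add: subfield_def divide_inverse)

lemma subfield_of_rat: "subfield K \<Longrightarrow> of_rat c \<in> K"
  by (cases c) (simp add: of_rat_rat subfield_divide subring_of_int subfield_is_subring)

text \<open>The N + 1 powers of \<open>y\<close> with exponents 0 to N lie in a space spanned by N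
  elements and are dependent. Dividing the relation by the lowest power of \<open>y\<close> that
  occurs leaves a nonzero constant term, and this expresses the inverse of \<open>y\<close> as a
  polynomial in \<open>y\<close>.\<close>

lemma subfield_rat_adjoin_root_of_unity:
  assumes z: "z ^ N = 1" "N > 0"
  shows "subfield (rat_adjoin z)"
proof -
  note A = is_subring_rat_adjoin[of z]
  have "inverse y \<in> rat_adjoin z" if y: "y \<in> rat_adjoin z" for y
  proof (cases "y = 0")
    case True
    then show ?thesis by (simp add: subring_0[OF A])
  next
    case False
    have "\<exists>c. y ^ i = (\<Sum>k<N. of_rat (c k) * z ^ k)" for i
      by (rule rat_adjoin_root_of_unity_span[OF z subring_power[OF A y]])
    then obtain C where C: "\<And>i. y ^ i = (\<Sum>k<N. of_rat (C i k) * z ^ k)" by metis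
    obtain x where x: "\<exists>i\<in>{..N}. x i \<noteq> 0" "(\<Sum>i\<le>N. of_rat (x i) * y ^ i) = 0"
      using rat_span_dependent[of "{..N}" "{..<N}" "\<lambda>i. y ^ i" C "\<lambda>k. z ^ k"] C by auto
    define k where "k = (LEAST i. x i \<noteq> 0)"
    obtain i0 where i0: "i0 \<le> N" "x i0 \<noteq> 0" using x(1) by auto
    have k: "x k \<noteq> 0" "k \<le> N" "\<And>i. i < k \<Longrightarrow> x i = 0"
      unfolding k_def using LeastI[of "\<lambda>i. x i \<noteq> 0", OF i0(2)]
        Least_le[of "\<lambda>i. x i \<noteq> 0", OF i0(2)] i0(1) not_less_Least by fastforce+
    define T where "T = (\<Sum>i\<in>{k<..N}. of_rat (x i) * y ^ (i - k - 1))"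
    have "{..N} = {..<k} \<union> insert k {k<..N}" "{..<k} \<inter> {k<..N} = {}" using k(2) by auto
    then have "(\<Sum>i\<le>N. of_rat (x i) * y ^ i) =
        (\<Sum>i<k. of_rat (x i) * y ^ i) + (of_rat (x k) * y ^ k + (\<Sum>i\<in>{k<..N}. of_rat (x i) * y ^ i))"
      by (simp add: sum.union_disjoint ivl_disj_int)
    also have "(\<Sum>i<k. of_rat (x i) * y ^ i) = 0" using k(3) by simp
    also have "(\<Sum>i\<in>{k<..N}. of_rat (x i) * y ^ i) = y ^ k * (y * T)"
      unfolding T_def sum_distrib_left
    proof (rule sum.cong)
      fix i assume "i \<in> {k<..N}"
      then have "i = k + Suc (i - k - 1)" by auto
      then have "y ^ i = y ^ k * (y * y ^ (i - k - 1))" by (metis power_add power_Suc)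
      then show "of_rat (x i) * y ^ i = y ^ k * (y * (of_rat (x i) * y ^ (i - k - 1)))" by simp
    qed simp
    finally have "y ^ k * (of_rat (x k) + y * T) = 0" using x(2) by (simp add: algebra_simps)
    then have "of_rat (x k) + y * T = 0" using False by simp
    then have "y * T = - of_rat (x k)" by (metis add.commute eq_neg_iff_add_eq_0)
    then have "of_rat (- 1 / x k) * (y * T) = 1"
      using k(1) by (simp add: of_rat_divide of_rat_minus)
    then have "y * (of_rat (- 1 / x k) * T) = 1" by (simp only: mult.left_commute)
    then have "inverse y = of_rat (- 1 / x k) * T" by (rule inverse_unique)
    also have "\<dots> \<in> rat_adjoin z"
      unfolding T_def by (intro subring_closed[OF A] of_rat_in_rat_adjoin y)
    finally show ?thesis .
  qed
  then show ?thesis unfolding subfield_def using subring_closed[OF A] by simp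
qed

lemma subfield_gen_field: "subfield (gen_field S)"
  unfolding gen_field_def subfield_def by auto

lemma gen_field_incl: "S \<subseteq> gen_field S"
  unfolding gen_field_def by auto

lemma gen_field_least: "subfield K \<Longrightarrow> S \<subseteq> K \<Longrightarrow> gen_field S \<subseteq> K"
  unfolding gen_field_def by auto

lemma gen_field_root_of_unity:
  assumes "z ^ N = 1" "N > 0"
  shows "gen_field {z} = rat_adjoin z"
proof
  show "gen_field {z} \<subseteq> rat_adjoin z"
    using subfield_rat_adjoin_root_of_unity[OF assms] generator_in_rat_adjoin
    by (intro gen_field_least) auto
  note F = subfield_gen_field[of "{z}"]
  note R = subring_closed[OF subfield_is_subring[OF F]]
  have "z \<in> gen_field {z}" using gen_field_incl by auto
  then show "rat_adjoin z \<subseteq> gen_field {z}"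
    by (auto simp: rat_adjoin_def poly_altdef intro!: R subfield_of_rat[OF F])
qed

lemma is_subring_algebraic_integer: "is_subring {x. algebraic_integer x}"
  using algebraic_integer_of_int[of 1]
  by (intro is_subringI)
     (auto simp only: mem_Collect_eq diff_conv_add_uminus of_int_1
       intro: algebraic_integer_add algebraic_integer_mult algebraic_integer_uminus)

lemma is_subring_ring_of_integers:
  assumes "subfield K"
  shows "is_subring (ring_of_integers K)"
  using subring_closed[OF subfield_is_subring[OF assms]] subring_closed[OF is_subring_algebraic_integer]
  by (intro is_subringI) (auto simp: ring_of_integers_def)

lemma int_adjoin_algebraic_integer:
  "algebraic_integer z \<Longrightarrow> x \<in> int_adjoin z \<Longrightarrow> algebraic_integer x"
  using subring_poly[OF is_subring_algebraic_integer, of z] by (auto simp: int_adjoin_def)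

section \<open>Ideals and the existence of prime ideals\<close>

definition is_ideal :: "complex set \<Rightarrow> complex set \<Rightarrow> bool" where
  "is_ideal R I \<longleftrightarrow> I \<subseteq> R \<and> 0 \<in> I \<and> (\<forall>x\<in>I. \<forall>y\<in>I. x + y \<in> I) \<and> (\<forall>r\<in>R. \<forall>x\<in>I. r * x \<in> I)"

lemma is_ideal_add_principal:
  assumes R: "is_subring R" and I: "is_ideal R I" and a: "a \<in> R"
  shows "is_ideal R {m + r * a | m r. m \<in> I \<and> r \<in> R}"
proof -
  note cl = subring_closed[OF R]
  let ?J = "{m + r * a | m r. m \<in> I \<and> r \<in> R}"
  have "x + y \<in> ?J" if "x \<in> ?J" "y \<in> ?J" for x y
  proof -
    from that obtain m r m' r' where *: "x = m + r * a" "y = m' + r' * a" "m \<in> I" "m' \<in> I" "r \<in> R" "r' \<in> R"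
      by auto
    then have "x + y = (m + m') + (r + r') * a" "m + m' \<in> I" "r + r' \<in> R"
      using I cl by (auto simp: algebra_simps is_ideal_def)
    then show ?thesis by blast
  qed
  moreover have "t * x \<in> ?J" if "x \<in> ?J" "t \<in> R" for x t
  proof -
    from that obtain m r where *: "x = m + r * a" "m \<in> I" "r \<in> R" by auto
    then have "t * x = t * m + (t * r) * a" "t * m \<in> I" "t * r \<in> R"
      using I cl that by (auto simp: algebra_simps is_ideal_def)
    then show ?thesis by blast
  qed
  moreover have "0 \<in> ?J"
  proof -
    have "0 = 0 + 0 * a" by simp
    then show ?thesis using I cl(1) unfolding is_ideal_def by blast
  qed
  moreover have "?J \<subseteq> R" using I a cl by (auto simp: is_ideal_def)
  ultimately show ?thesis unfolding is_ideal_def by blast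
qed

text \<open>Zorn's lemma yields an ideal \<open>M\<close> maximal among the proper ideals containing
  \<open>J\<close>. It is prime: for \<open>x\<close> outside \<open>M\<close> one has
  \<open>1 = m + r * x\<close>, and multiplying by \<open>y\<close> puts \<open>y\<close> into
  \<open>M\<close> as soon as \<open>x * y\<close> is there.\<close>

lemma exists_prime_ideal_above:
  assumes R: "is_subring R" and J: "is_ideal R J" "1 \<notin> J"
  shows "\<exists>Q. prime_ideal_of R Q \<and> J \<subseteq> Q"
proof -
  note cl = subring_closed[OF R]
  let ?S = "{I. is_ideal R I \<and> 1 \<notin> I \<and> J \<subseteq> I}"
  have "\<exists>M\<in>?S. \<forall>X\<in>?S. M \<subseteq> X \<longrightarrow> X = M"
  proof (rule subset_Zorn_nonempty)
    show "?S \<noteq> {}" using J by auto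
  next
    fix C assume C: "C \<noteq> {}" "subset.chain ?S C"
    then have CS: "I \<in> C \<Longrightarrow> I \<in> ?S" for I by (auto simp: subset.chain_def)
    have ch: "I \<subseteq> I' \<or> I' \<subseteq> I" if "I \<in> C" "I' \<in> C" for I I'
      using C that by (auto simp: subset_chain_def)
    obtain I0 where I0: "I0 \<in> C" using C by auto
    have "x + y \<in> \<Union>C" if xy: "x \<in> \<Union>C" "y \<in> \<Union>C" for x y
    proof -
      from xy obtain I I' where I: "I \<in> C" "I' \<in> C" "x \<in> I" "y \<in> I'" by auto
      with ch obtain I'' where "I'' \<in> C" "x \<in> I''" "y \<in> I''" by blast
      moreover from this CS have "is_ideal R I''" by blast
      ultimately show ?thesis by (auto simp: is_ideal_def)
    qed
    moreover have "\<Union>C \<subseteq> R" "0 \<in> \<Union>C" "1 \<notin> \<Union>C" "J \<subseteq> \<Union>C" "\<And>r x. r \<in> R \<Longrightarrow> x \<in> \<Union>C \<Longrightarrow> r * x \<in> \<Union>C"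
    proof -
      have CI: "I \<subseteq> R" "0 \<in> I" "1 \<notin> I" "J \<subseteq> I" "\<And>r x. r \<in> R \<Longrightarrow> x \<in> I \<Longrightarrow> r * x \<in> I"
        if "I \<in> C" for I using CS[OF that] by (auto simp: is_ideal_def)
      show "\<Union>C \<subseteq> R" "0 \<in> \<Union>C" "1 \<notin> \<Union>C" "J \<subseteq> \<Union>C" using CI(1-4) I0 by blast+
      show "\<And>r x. r \<in> R \<Longrightarrow> x \<in> \<Union>C \<Longrightarrow> r * x \<in> \<Union>C" using CI(5) by blast
    qed
    ultimately show "\<Union>C \<in> ?S" unfolding is_ideal_def mem_Collect_eq by (intro conjI ballI)
  qed
  then obtain M where MS: "M \<in> ?S" "\<forall>X\<in>?S. M \<subseteq> X \<longrightarrow> X = M" by (elim bexE)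
  then have M: "is_ideal R M" "1 \<notin> M" "J \<subseteq> M" by simp_all
  have max: "X = M" if "is_ideal R X" "1 \<notin> X" "J \<subseteq> X" "M \<subseteq> X" for X
    using MS(2) that by simp
  have "y \<in> M" if xy: "x \<in> R" "y \<in> R" "x * y \<in> M" "x \<notin> M" for x y
  proof -
    let ?X = "{m + r * x | m r. m \<in> M \<and> r \<in> R}"
    have X: "is_ideal R ?X" by (rule is_ideal_add_principal[OF R M(1) xy(1)])
    have MX: "M \<subseteq> ?X"
    proof
      fix m assume "m \<in> M"
      moreover have "m = m + 0 * x" by simp
      ultimately show "m \<in> ?X" using cl(1) by blast
    qed
    have "0 + 1 * x \<in> ?X" using M(1) cl(2) unfolding is_ideal_def by blast
    then have "?X \<noteq> M" using xy(4) by auto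
    then have "1 \<in> ?X" using max[OF X] M(3) MX by blast
    then obtain m r where mr: "1 = m + r * x" "m \<in> M" "r \<in> R" by blast
    then have "y = y * m + r * (x * y)" by (metis distrib_left mult.assoc mult.commute mult.right_neutral)
    then show ?thesis using M(1) xy mr unfolding is_ideal_def by metis
  qed
  then have "prime_ideal_of R M" using M cl(2) unfolding prime_ideal_of_def is_ideal_def by blast
  then show ?thesis using M by blast
qed

context
  fixes R P assumes R: "is_subring R" and P: "prime_ideal_of R P"
begin

lemma prime_ideal_add: "x \<in> P \<Longrightarrow> y \<in> P \<Longrightarrow> x + y \<in> P"
  using P by (simp add: prime_ideal_of_def)

lemma prime_ideal_0: "0 \<in> P"
  using P by (simp add: prime_ideal_of_def)

lemma prime_ideal_subset: "x \<in> P \<Longrightarrow> x \<in> R"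
  using P by (auto simp: prime_ideal_of_def)

lemma prime_ideal_mult: "r \<in> R \<Longrightarrow> x \<in> P \<Longrightarrow> r * x \<in> P"
  using P by (simp add: prime_ideal_of_def)

lemma prime_ideal_mult_right: "r \<in> R \<Longrightarrow> x \<in> P \<Longrightarrow> x * r \<in> P"
  using prime_ideal_mult by (simp add: mult.commute)

lemma prime_ideal_uminus: "x \<in> P \<Longrightarrow> - x \<in> P"
  using prime_ideal_mult[of "-1" x] subring_uminus[OF R subring_1[OF R]] by simp

lemma prime_ideal_diff: "x \<in> P \<Longrightarrow> y \<in> P \<Longrightarrow> x - y \<in> P"
  using prime_ideal_add[of x "- y"] prime_ideal_uminus by simp

lemma prime_ideal_prime: "x \<in> R \<Longrightarrow> y \<in> R \<Longrightarrow> x * y \<in> P \<Longrightarrow> x \<in> P \<or> y \<in> P"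
  using P by (simp add: prime_ideal_of_def)

lemma prime_ideal_1: "1 \<notin> P"
proof
  assume "1 \<in> P"
  then have "R \<subseteq> P" using prime_ideal_mult[of _ 1] by auto
  then show False using P by (auto simp: prime_ideal_of_def)
qed

lemma prime_ideal_sum: "(\<And>i. i \<in> I \<Longrightarrow> f i \<in> P) \<Longrightarrow> (\<Sum>i\<in>I. f i) \<in> P"
  by (induction I rule: infinite_finite_induct) (auto intro: prime_ideal_0 prime_ideal_add)

text \<open>An integer prime to p inside \<open>P\<close> would put 1 into \<open>P\<close> by
  Bezout. Through this, membership in a prime ideal is translated to and from congruences of
  integers.\<close>

lemma prime_ideal_of_int_iff:
  assumes "prime p" "of_nat p \<in> P"
  shows "of_int k \<in> P \<longleftrightarrow> int p dvd k"
proof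
  assume "int p dvd k"
  then obtain m where "k = int p * m" by blast
  then have "complex_of_int k = of_int m * of_nat p" by simp
  then show "of_int k \<in> P" using prime_ideal_mult[OF subring_of_int[OF R] assms(2)] by simp
next
  assume k: "of_int k \<in> P"
  show "int p dvd k"
  proof (rule ccontr)
    assume "\<not> int p dvd k"
    then have "coprime (int p) k" using assms(1) by (simp add: prime_imp_coprime)
    then obtain u v where "u * int p + v * k = 1" using bezout_int[of "int p" k] by auto
    then have "of_int u * of_nat p + of_int v * of_int k = (1::complex)"
      by (metis of_int_1 of_int_add of_int_mult of_int_of_nat_eq)
    then show False using prime_ideal_1 prime_ideal_add prime_ideal_mult subring_of_int[OF R] k assms(2)
      by metis
  qed
qed

lemma prime_ideal_of_nat_iff:
  assumes "prime p" "of_nat p \<in> P"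
  shows "of_nat k \<in> P \<longleftrightarrow> p dvd k"
  using prime_ideal_of_int_iff[OF assms, of "int k"] by simp

end

section \<open>The p-th cyclotomic field\<close>

lemma poly_of_int_pcompose:
  "poly (map_poly of_int (pcompose g q)) (x :: complex) = poly (map_poly of_int g) (poly (map_poly of_int q) x)"
  by (induction g) (simp_all add: pcompose_pCons of_int_hom.map_poly_pCons_hom hom_distribs)

lemma poly_of_rat_pcompose:
  "poly (map_poly of_rat (pcompose g q)) (x :: complex) = poly (map_poly of_rat g) (poly (map_poly of_rat q) x)"
  by (induction g) (simp_all add: pcompose_pCons of_rat_hom.map_poly_pCons_hom
      of_rat_poly_hom.hom_add of_rat_poly_hom.hom_mult)

lemma primitive_root_power_eq_1_iff:
  assumes "primitive_root n z" "n > 0"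
  shows "z ^ k = 1 \<longleftrightarrow> n dvd k"
proof -
  have zn: "z ^ n = 1" using assms by (simp add: primitive_root_def)
  have "z ^ k = z ^ (k mod n)" by (rule power_mod_root_of_unity[OF zn]) (simp add: cong_def)
  moreover have "z ^ (k mod n) = 1 \<longleftrightarrow> k mod n = 0"
    using assms by (auto simp: primitive_root_def)
  ultimately show ?thesis by (simp add: dvd_eq_mod_eq_0)
qed

context
  fixes p :: nat and \<zeta> :: complex
  assumes p: "prime p" and zeta: "primitive_root p \<zeta>"
begin

lemma zeta_pow_p: "\<zeta> ^ p = 1"
  using zeta by (simp add: primitive_root_def)

lemma zeta_ne_1: "\<zeta> \<noteq> 1"
  using primitive_root_power_eq_1_iff[OF zeta prime_gt_0_nat[OF p], of 1] p by auto

lemma zeta_minus_1_in: "\<zeta> - 1 \<in> int_adjoin \<zeta>"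
  by (intro subring_closed[OF is_subring_int_adjoin] generator_in_int_adjoin)

text \<open>Expand ((\<zeta> - 1) + 1) ^ p = 1 in powers of \<zeta> - 1 and divide by \<zeta> - 1.
  Every middle coefficient contains p, so p and (\<zeta> - 1) ^ (p - 1) agree up to sign and an
  error p (\<zeta> - 1) s.\<close>

lemma prime_eisenstein_relation:
  "\<exists>s\<in>int_adjoin \<zeta>. of_nat p = - ((\<zeta> - 1) ^ (p - 1)) - of_nat p * (\<zeta> - 1) * s"
proof -
  define x where "x = \<zeta> - 1"
  note cl = subring_closed[OF is_subring_int_adjoin[of \<zeta>]]
  have p2: "p \<ge> 2" using p prime_ge_2_nat by blast
  have x0: "x \<noteq> 0" using zeta_ne_1 by (simp add: x_def)
  define s where "s = (\<Sum>k\<in>{1<..<p}. of_nat ((p choose k) div p) * x ^ (k - 2))"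
  have "{..p} = insert 0 (insert 1 (insert p {1<..<p}))" using p2 by auto
  then have "(x + 1) ^ p = 1 + (of_nat p * x + (x ^ p + (\<Sum>k\<in>{1<..<p}. of_nat (p choose k) * x ^ k)))"
    unfolding binomial_ring using p2 by simp
  also have "(\<Sum>k\<in>{1<..<p}. of_nat (p choose k) * x ^ k) = of_nat p * x * x * s"
    unfolding s_def sum_distrib_left
  proof (rule sum.cong)
    fix k assume k: "k \<in> {1<..<p}"
    then have "p dvd (p choose k)" using p by (intro dvd_choose_prime) auto
    then have "p choose k = p * ((p choose k) div p)" by simp
    then have "complex_of_nat (p choose k) = of_nat p * of_nat ((p choose k) div p)"
      by (metis of_nat_mult)
    moreover have "k = Suc (Suc (k - 2))" using k by auto
    then have "x ^ k = x * (x * x ^ (k - 2))" by (metis power_Suc)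
    ultimately show "of_nat (p choose k) * x ^ k = of_nat p * x * x * (of_nat ((p choose k) div p) * x ^ (k - 2))"
      by simp
  qed simp
  also have "x ^ p = x * x ^ (p - 1)" using p2 by (metis power_Suc Suc_diff_1 prime_gt_0_nat p)
  finally have "x * (of_nat p + x ^ (p - 1) + of_nat p * x * s) = 0"
    using zeta_pow_p by (simp add: x_def algebra_simps)
  then have "of_nat p + x ^ (p - 1) + of_nat p * x * s = 0" using x0 by simp
  then have "of_nat p = - (x ^ (p - 1)) - of_nat p * x * s"
    by (simp add: eq_diff_eq eq_neg_iff_add_eq_0 algebra_simps)
  moreover have "s \<in> int_adjoin \<zeta>"
    unfolding s_def x_def by (intro cl zeta_minus_1_in)
  ultimately show ?thesis unfolding x_def by blast
qed

lemma prime_dvd_zeta_minus_1_power: "\<exists>w\<in>int_adjoin \<zeta>. (\<zeta> - 1) ^ (p - 1) = of_nat p * w"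
proof -
  note cl = subring_closed[OF is_subring_int_adjoin[of \<zeta>]]
  obtain s where s: "s \<in> int_adjoin \<zeta>" "of_nat p = - ((\<zeta> - 1) ^ (p - 1)) - of_nat p * (\<zeta> - 1) * s"
    using prime_eisenstein_relation by blast
  show ?thesis
  proof (rule bexI)
    show "- 1 - (\<zeta> - 1) * s \<in> int_adjoin \<zeta>" by (intro cl zeta_minus_1_in s)
    have "(\<zeta> - 1) ^ (p - 1) = - of_nat p - of_nat p * (\<zeta> - 1) * s" by (subst s(2)) simp
    then show "(\<zeta> - 1) ^ (p - 1) = of_nat p * (- 1 - (\<zeta> - 1) * s)" by (simp add: algebra_simps)
  qed
qed

text \<open>Bootstrapping: inserting p = (\<zeta> - 1) ^ j w into the error term of the relation
  raises j by one. This replaces inverting 1 + (\<zeta> - 1) s.\<close>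

lemma zeta_minus_1_power_dvd_prime:
  "j \<le> p - 1 \<Longrightarrow> \<exists>w\<in>int_adjoin \<zeta>. of_nat p = (\<zeta> - 1) ^ j * w"
proof (induction j)
  case 0
  show ?case using subring_of_nat[OF is_subring_int_adjoin, of p \<zeta>] by (intro bexI[of _ "of_nat p"]) auto
next
  case (Suc j)
  note cl = subring_closed[OF is_subring_int_adjoin[of \<zeta>]]
  define x where "x = \<zeta> - 1"
  have x: "x \<in> int_adjoin \<zeta>" using zeta_minus_1_in by (simp add: x_def)
  obtain w where w: "w \<in> int_adjoin \<zeta>" "of_nat p = x ^ j * w" using Suc unfolding x_def by auto
  obtain s where s: "s \<in> int_adjoin \<zeta>" "of_nat p = - (x ^ (p - 1)) - of_nat p * x * s"
    using prime_eisenstein_relation unfolding x_def by blast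
  have "p - 1 = Suc j + (p - 1 - Suc j)" using Suc.prems by simp
  then have "x ^ (p - 1) = x ^ Suc j * x ^ (p - 1 - Suc j)" by (metis power_add)
  then have "of_nat p = x ^ Suc j * (- (x ^ (p - 1 - Suc j)) - w * s)"
    using s(2) unfolding w(2) by (simp add: algebra_simps)
  then show ?case unfolding x_def[symmetric]
    by (rule bexI) (intro cl x w s)
qed

lemma zeta_algebraic_integer: "algebraic_integer \<zeta>"
  using algebraic_integer_root_of_int[of \<zeta> p 1] zeta_pow_p prime_gt_0_nat[OF p] by simp

text \<open>Irreducibility of the p-th cyclotomic polynomial by comparing powers of \<open>\<zeta> - 1\<close>, whose
  (p - 1)-th power is associated to p: a coefficient that is not yet known to be divisible by p
  must be divisible by \<open>\<zeta> - 1\<close>, hence by p.\<close>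

lemma prime_dvd_coeff_if_root_zeta_minus_1:
  fixes g :: "int poly"
  assumes deg: "degree g < p - 1" and root: "poly (map_poly of_int g) (\<zeta> - 1) = 0"
  shows "int p dvd coeff g k"
proof (induction k rule: less_induct)
  case (less k)
  note cl = subring_closed[OF is_subring_int_adjoin[of \<zeta>]]
  define x where "x = \<zeta> - 1"
  have x: "x \<in> int_adjoin \<zeta>" using zeta_minus_1_in by (simp add: x_def)
  have x0: "x \<noteq> 0" using zeta_ne_1 by (simp add: x_def)
  have p2: "p \<ge> 2" using p prime_ge_2_nat by blast
  show ?case
  proof (cases "k \<le> degree g")
    case False
    then show ?thesis by (simp add: coeff_eq_0)
  next
    case True
    then have kp: "Suc k \<le> p - 1" using deg by simp
    obtain w where w: "w \<in> int_adjoin \<zeta>" "of_nat p = x ^ Suc k * w"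
      using zeta_minus_1_power_dvd_prime[OF kp] unfolding x_def by blast
    have "\<exists>v\<in>int_adjoin \<zeta>. of_int (coeff g i) * x ^ i = x ^ Suc k * v" if "i \<noteq> k" for i
    proof (cases "i < k")
      case True
      then obtain b where "coeff g i = int p * b" using less by (meson dvdE)
      then have "of_int (coeff g i) * x ^ i = x ^ Suc k * (w * of_int b * x ^ i)"
        using w(2) by simp
      then show ?thesis by (rule bexI) (intro cl w x)
    next
      case False
      with that have "i = Suc k + (i - Suc k)" by simp
      then have "x ^ i = x ^ Suc k * x ^ (i - Suc k)" by (metis power_add)
      then have "of_int (coeff g i) * x ^ i = x ^ Suc k * (of_int (coeff g i) * x ^ (i - Suc k))"
        by simp
      then show ?thesis by (rule bexI) (intro cl x)
    qed
    then obtain v where v: "\<And>i. i \<noteq> k \<Longrightarrow> v i \<in> int_adjoin \<zeta>"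
      "\<And>i. i \<noteq> k \<Longrightarrow> of_int (coeff g i) * x ^ i = x ^ Suc k * v i" by metis
    define V where "V = (\<Sum>i\<in>{..degree g} - {k}. v i)"
    have V: "V \<in> int_adjoin \<zeta>" unfolding V_def by (intro cl v) auto
    have "0 = (\<Sum>i\<le>degree g. of_int (coeff g i) * x ^ i)"
      using root by (simp add: poly_altdef x_def)
    also have "\<dots> = of_int (coeff g k) * x ^ k + (\<Sum>i\<in>{..degree g} - {k}. of_int (coeff g i) * x ^ i)"
      using True by (intro sum.remove) auto
    also have "(\<Sum>i\<in>{..degree g} - {k}. of_int (coeff g i) * x ^ i) = x ^ Suc k * V"
      unfolding V_def sum_distrib_left by (rule sum.cong) (auto simp: v(2))
    finally have "x ^ k * (of_int (coeff g k) + x * V) = 0" by (simp add: algebra_simps)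
    then have "of_int (coeff g k) + x * V = 0" using x0 by simp
    then have bk: "of_int (coeff g k) = x * (- V)" by (simp add: eq_neg_iff_add_eq_0)
    \<comment> \<open>The coefficient is divisible by \<open>x\<close> in \<int>[\<zeta>], so its
      power with exponent p - 1 is divisible by p there. The quotient \<open>u\<close> is both
      rational and an algebraic integer, which brings the divisibility down to \<int>.\<close>
    obtain w' where w': "w' \<in> int_adjoin \<zeta>" "x ^ (p - 1) = of_nat p * w'"
      using prime_dvd_zeta_minus_1_power unfolding x_def by blast
    define u where "u = w' * (- V) ^ (p - 1)"
    have "of_int (coeff g k) ^ (p - 1) = of_nat p * u"
      unfolding bk power_mult_distrib w'(2) u_def by simp
    then have eq: "of_int (coeff g k ^ (p - 1)) = of_nat p * u" by simp
    then have "u = of_int (coeff g k ^ (p - 1)) / of_nat p" using p2 by simp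
    then have "u \<in> \<rat>" by simp
    moreover have "algebraic_integer u"
      by (rule int_adjoin_algebraic_integer[OF zeta_algebraic_integer])
         (unfold u_def, intro cl w' V)
    ultimately have "u \<in> \<int>" by (intro algebraic_integer_rational)
    then obtain m where "u = of_int m" by (auto elim: Ints_cases)
    with eq have "complex_of_int (coeff g k ^ (p - 1)) = of_int (int p * m)" by simp
    then have "coeff g k ^ (p - 1) = int p * m" by (simp only: of_int_eq_iff)
    then have "int p dvd coeff g k ^ (p - 1)" by simp
    then show ?thesis using p by (meson prime_dvd_power prime_nat_int_transfer)
  qed
qed

text \<open>After the substitution X + 1 the root is \<zeta> - 1. The primitive part has the same
  root, so p divides all its coefficients, contradicting content 1.\<close>

lemma int_poly_root_zeta_eq_0:
  fixes g :: "int poly"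
  assumes deg: "degree g < p - 1" and root: "poly (map_poly of_int g) \<zeta> = 0"
  shows "g = 0"
proof (rule ccontr)
  assume "g \<noteq> 0"
  define G where "G = pcompose g [:1, 1:]"
  have "G \<noteq> 0" unfolding G_def using \<open>g \<noteq> 0\<close> by (metis pcompose_eq_0 degree_pCons_eq_if one_pCons pCons_eq_0_iff one_neq_zero zero_less_Suc)
  define H where "H = primitive_part G"
  have GH: "G = smult (content G) H" by (simp add: H_def)
  have c0: "content G \<noteq> 0" using \<open>G \<noteq> 0\<close> by simp
  have "degree H = degree g" using GH c0 unfolding G_def
    by (metis degree_pCons_eq_if degree_pcompose degree_primitive_part H_def G_def mult.right_neutral one_neq_zero pCons_eq_0_iff One_nat_def degree_0)
  moreover have "poly (map_poly of_int H) (\<zeta> - 1) = 0"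
  proof -
    have "poly (map_poly of_int G) (\<zeta> - 1) = 0"
      unfolding G_def poly_of_int_pcompose using root by (simp add: of_int_hom.map_poly_pCons_hom)
    then have "of_int (content G) * poly (map_poly of_int H) (\<zeta> - 1) = 0"
      by (subst (asm) GH) (simp add: hom_distribs)
    then show ?thesis using c0 by simp
  qed
  ultimately have "int p dvd coeff H k" for k
    using prime_dvd_coeff_if_root_zeta_minus_1[of H k] deg by simp
  then have "[:int p:] dvd H" by (simp add: const_poly_dvd_iff)
  then have "int p dvd content H" by (simp add: const_poly_dvd_iff_dvd_content)
  moreover have "content H = 1" unfolding H_def using \<open>G \<noteq> 0\<close> by simp
  ultimately show False using p by simp
qed

lemma sum_powers_root_of_unity_eq_0:
  assumes "\<not> p dvd t"
  shows "(\<Sum>k<p. (\<zeta> ^ t) ^ k) = 0"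
proof -
  have "\<zeta> ^ t \<noteq> 1" using primitive_root_power_eq_1_iff[OF zeta prime_gt_0_nat[OF p]] assms by simp
  moreover have "(\<zeta> ^ t) ^ p = 1" using zeta_pow_p by (metis power_commutes power_mult power_one mult.commute)
  ultimately show ?thesis by (simp add: sum_gp_strict)
qed

text \<open>Division by 1 + X + ... + X ^ (p - 1), which vanishes at every \<zeta> ^ t with t prime
  to p. The remainder has degree below p - 1 or is zero, and it vanishes at \<zeta>, so it is
  zero.\<close>

lemma rat_poly_root_conjugate:
  fixes f :: "rat poly"
  assumes root: "poly (map_poly of_rat f) \<zeta> = 0" and t: "\<not> p dvd t"
  shows "poly (map_poly of_rat f) (\<zeta> ^ t) = 0"
proof -
  have p2: "p \<ge> 2" using p prime_ge_2_nat by blast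
  define \<Phi> :: "rat poly" where "\<Phi> = (\<Sum>k<p. monom 1 k)"
  have "coeff \<Phi> k = (if k < p then 1 else 0)" for k
    unfolding \<Phi>_def coeff_sum by (simp add: if_distrib sum.delta' cong: if_cong)
  then have deg: "degree \<Phi> = p - 1"
    using p2 by (intro antisym degree_le le_degree) auto
  have ev: "poly (map_poly of_rat \<Phi>) x = (\<Sum>k<p. x ^ k)" for x :: complex
    unfolding \<Phi>_def by (simp add: of_rat_poly_hom.hom_sum poly_sum map_poly_monom poly_monom)
  define q r where "q = f div \<Phi>" and "r = f mod \<Phi>"
  have f: "f = \<Phi> * q + r" by (simp add: q_def r_def)
  have ev_f: "poly (map_poly of_rat f) x = (\<Sum>k<p. x ^ k) * poly (map_poly of_rat q) x + poly (map_poly of_rat r) x"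
    for x :: complex
    by (simp add: f of_rat_poly_hom.hom_add of_rat_poly_hom.hom_mult ev)
  have "(\<Sum>k<p. \<zeta> ^ k) = 0"
    using sum_powers_root_of_unity_eq_0[of 1] p2 by simp
  with root have r0: "poly (map_poly of_rat r) \<zeta> = 0" by (simp add: ev_f)
  have "\<Phi> \<noteq> 0" using deg p2 by auto
  then have degr: "r = 0 \<or> degree r < p - 1" using degree_mod_less[of \<Phi> f] deg by (simp add: r_def)
  have "r = 0"
  proof (rule ccontr)
    assume "r \<noteq> 0"
    then have degr: "degree r < p - 1" using degr by simp
    obtain d g where d: "d > 0" "smult (of_nat d) r = map_poly of_int (g :: int poly)"
      using rat_poly_common_denominator by blast
    have "degree (map_poly of_int g :: rat poly) = degree r" using d by (simp flip: d(2))
    then have "degree g < p - 1" using degr by simp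
    moreover have "poly (map_poly of_int g) \<zeta> = 0"
    proof -
      have "poly (map_poly of_int g) \<zeta> = poly (map_poly of_rat (map_poly of_int g)) \<zeta>"
        by (simp add: map_poly_map_poly o_def)
      also have "\<dots> = of_nat d * poly (map_poly of_rat r) \<zeta>"
        unfolding d(2)[symmetric] by (simp add: hom_distribs)
      finally show ?thesis using r0 by simp
    qed
    ultimately have "g = 0" by (rule int_poly_root_zeta_eq_0)
    then show False using d \<open>r \<noteq> 0\<close> by simp
  qed
  then show ?thesis by (simp add: ev_f sum_powers_root_of_unity_eq_0[OF t])
qed

end

section \<open>Independence of characters and the bound by the degree\<close>

text \<open>Dedekind's argument: from the relation at \<open>y * x\<close> subtract
  \<open>\<phi> k y\<close> times the relation at \<open>x\<close>. This removes the index
  \<open>k\<close> and multiplies each other coefficient by \<open>\<phi> i y - \<phi> k y\<close>,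
  which is nonzero for \<open>i = j\<close> when \<open>y\<close> separates \<open>j\<close> from
  \<open>k\<close>.\<close>

lemma characters_independent:
  fixes \<phi> :: "'i \<Rightarrow> complex \<Rightarrow> complex"
  assumes "finite I" and K: "1 \<in> K" "\<And>x y. x \<in> K \<Longrightarrow> y \<in> K \<Longrightarrow> x * y \<in> K"
    and mult: "\<And>i x y. i \<in> I \<Longrightarrow> x \<in> K \<Longrightarrow> y \<in> K \<Longrightarrow> \<phi> i (x * y) = \<phi> i x * \<phi> i y"
    and one: "\<And>i. i \<in> I \<Longrightarrow> \<phi> i 1 = 1"
    and dist: "\<And>i j. i \<in> I \<Longrightarrow> j \<in> I \<Longrightarrow> i \<noteq> j \<Longrightarrow> \<exists>x\<in>K. \<phi> i x \<noteq> \<phi> j x"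
    and rel: "\<And>x. x \<in> K \<Longrightarrow> (\<Sum>i\<in>I. c i * \<phi> i x) = 0"
  shows "\<forall>i\<in>I. c i = 0"
  using assms(1,4-)
proof (induction I arbitrary: c rule: finite_induct)
  case empty
  then show ?case by simp
next
  case (insert k I)
  have c0: "c j = 0" if j: "j \<in> I" for j
  proof -
    have "k \<noteq> j" using j insert.hyps by auto
    then obtain y where y: "y \<in> K" "\<phi> k y \<noteq> \<phi> j y"
      using insert.prems(3)[of k j] j by auto
    have "\<forall>i\<in>I. c i * (\<phi> i y - \<phi> k y) = 0"
    proof (rule insert.IH)
      fix x assume x: "x \<in> K"
      have "(\<Sum>i\<in>insert k I. c i * \<phi> i (y * x)) - \<phi> k y * (\<Sum>i\<in>insert k I. c i * \<phi> i x) = 0"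
        using insert.prems(4) K(2) x y(1) by simp
      also have "(\<Sum>i\<in>insert k I. c i * \<phi> i (y * x)) - \<phi> k y * (\<Sum>i\<in>insert k I. c i * \<phi> i x) =
          (\<Sum>i\<in>insert k I. c i * (\<phi> i y - \<phi> k y) * \<phi> i x)"
        unfolding sum_distrib_left sum_subtractf[symmetric]
        by (rule sum.cong) (use insert.prems(1) x y(1) in \<open>auto simp: algebra_simps\<close>)
      also have "\<dots> = (\<Sum>i\<in>I. c i * (\<phi> i y - \<phi> k y) * \<phi> i x)" using insert.hyps by simp
      finally show "(\<Sum>i\<in>I. c i * (\<phi> i y - \<phi> k y) * \<phi> i x) = 0" .
    qed (use insert.prems in auto)
    then show ?thesis using y(2) j by auto
  qed
  have "(\<Sum>i\<in>insert k I. c i * \<phi> i 1) = 0" by (rule insert.prems(4)[OF K(1)])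
  then have "c k = 0" using insert.hyps insert.prems(2) c0 by simp
  then show ?case using c0 by simp
qed

text \<open>With more maps than basis elements, the values on the basis satisfy a nontrivial complex
  relation between the maps. Rational linearity extends it to all of \<open>K\<close>, against
  independence.\<close>

lemma card_characters_le_degree:
  fixes \<phi> :: "'i \<Rightarrow> complex \<Rightarrow> complex"
  assumes I: "finite I" and K: "subfield K" "degree_over_Q K n"
    and add: "\<And>i x y. i \<in> I \<Longrightarrow> x \<in> K \<Longrightarrow> y \<in> K \<Longrightarrow> \<phi> i (x + y) = \<phi> i x + \<phi> i y"
    and mult: "\<And>i x y. i \<in> I \<Longrightarrow> x \<in> K \<Longrightarrow> y \<in> K \<Longrightarrow> \<phi> i (x * y) = \<phi> i x * \<phi> i y"
    and rat: "\<And>i c. i \<in> I \<Longrightarrow> \<phi> i (of_rat c) = of_rat c"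
    and dist: "\<And>i j. i \<in> I \<Longrightarrow> j \<in> I \<Longrightarrow> i \<noteq> j \<Longrightarrow> \<exists>x\<in>K. \<phi> i x \<noteq> \<phi> j x"
  shows "card I \<le> n"
proof (rule ccontr)
  assume "\<not> card I \<le> n"
  note cl = subring_closed[OF subfield_is_subring[OF K(1)]]
  from K(2) obtain B where B: "finite B" "card B = n" "B \<subseteq> K"
    "\<And>x. x \<in> K \<Longrightarrow> \<exists>c. x = (\<Sum>b\<in>B. of_rat (c b) * b)"
    unfolding degree_over_Q_def by blast
  have "card B < card I" using \<open>\<not> card I \<le> n\<close> B by simp
  from homogeneous_system_nontrivial_solution[OF B(1) I this, of \<phi>] obtain c where
    c: "\<exists>i\<in>I. c i \<noteq> 0" "\<And>b. b \<in> B \<Longrightarrow> (\<Sum>i\<in>I. c i * \<phi> i b) = 0" by blast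
  have lin: "\<phi> i (\<Sum>b\<in>B'. of_rat (d b) * b) = (\<Sum>b\<in>B'. of_rat (d b) * \<phi> i b)"
    if "i \<in> I" "finite B'" "B' \<subseteq> B" for i B' d
    using that(2,3)
  proof (induction B' rule: finite_induct)
    case empty
    show ?case using rat[OF that(1), of 0] by simp
  next
    case (insert b B')
    have b: "b \<in> K" "of_rat (d b) \<in> K" using insert.prems B(3) subfield_of_rat[OF K(1)] by auto
    have "(\<Sum>b\<in>B'. of_rat (d b) * b) \<in> K"
      by (intro cl subfield_of_rat[OF K(1)]) (use insert.prems B(3) in auto)
    then show ?case using insert b add[OF that(1)] mult[OF that(1)] rat[OF that(1)]
      by (simp add: cl)
  qed
  have rel: "(\<Sum>i\<in>I. c i * \<phi> i x) = 0" if x: "x \<in> K" for x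
  proof -
    obtain d where d: "x = (\<Sum>b\<in>B. of_rat (d b) * b)" using B(4)[OF x] by blast
    have "(\<Sum>i\<in>I. c i * \<phi> i x) = (\<Sum>i\<in>I. \<Sum>b\<in>B. c i * (of_rat (d b) * \<phi> i b))"
      unfolding d using lin[OF _ B(1)] by (simp add: sum_distrib_left)
    also have "\<dots> = (\<Sum>b\<in>B. \<Sum>i\<in>I. c i * (of_rat (d b) * \<phi> i b))" by (rule sum.swap)
    also have "\<dots> = (\<Sum>b\<in>B. of_rat (d b) * (\<Sum>i\<in>I. c i * \<phi> i b))"
      by (simp add: sum_distrib_left mult.left_commute)
    also have "\<dots> = 0" using c(2) by simp
    finally show ?thesis .
  qed
  have "\<forall>i\<in>I. c i = 0"
  proof (rule characters_independent[where K = K and \<phi> = \<phi>])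
    show "\<phi> i 1 = 1" if "i \<in> I" for i using rat[OF that, of 1] by simp
  qed (use I cl(2,4) mult dist rel in auto)
  then show False using c(1) by blast
qed

text \<open>The automorphism \<open>\<zeta> \<mapsto> \<zeta> ^ t\<close>: by irreducibility of the p-th cyclotomic polynomial the value
  does not depend on the chosen h when t is prime to p. Outside \<open>\<rat>(\<zeta>)\<close> the value is junk.\<close>

definition conj_map :: "complex \<Rightarrow> nat \<Rightarrow> complex \<Rightarrow> complex" where
  "conj_map \<zeta> t x = poly (map_poly of_rat (SOME h. poly (map_poly of_rat h) \<zeta> = x)) (\<zeta> ^ t)"

text \<open>The power \<sigma> ^ j of the automorphism \<sigma> with \<zeta> \<mapsto> \<zeta> ^ g:
  composition adds exponents, and j counts only modulo p - 1.\<close>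

definition primroot_conj :: "complex \<Rightarrow> nat \<Rightarrow> nat \<Rightarrow> complex \<Rightarrow> complex" where
  "primroot_conj \<zeta> g j x = conj_map \<zeta> (g ^ j) x"

text \<open>The Gaussian period: for \<open>e\<close> dividing p - 1, the sum over the orbit of
  \<open>\<zeta> ^ (g ^ j)\<close> under \<sigma> ^ e.\<close>

definition period :: "nat \<Rightarrow> complex \<Rightarrow> nat \<Rightarrow> nat \<Rightarrow> nat \<Rightarrow> complex" where
  "period p \<zeta> g e j = (\<Sum>i<(p - 1) div e. \<zeta> ^ (g ^ (e * i + j)))"

lemma conj_map_cong: "\<zeta> ^ t = \<zeta> ^ u \<Longrightarrow> conj_map \<zeta> t x = conj_map \<zeta> u x"
  by (simp add: conj_map_def)

context
  fixes p :: nat and \<zeta> :: complex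
  assumes p: "prime p" and zeta: "primitive_root p \<zeta>"
begin

lemma conj_map_poly:
  assumes "\<not> p dvd t"
  shows "conj_map \<zeta> t (poly (map_poly of_rat h) \<zeta>) = poly (map_poly of_rat h) (\<zeta> ^ t)"
proof -
  define k where "k = (SOME k. poly (map_poly of_rat k) \<zeta> = poly (map_poly of_rat h) \<zeta>)"
  have "poly (map_poly of_rat k) \<zeta> = poly (map_poly of_rat h) \<zeta>"
    unfolding k_def by (rule someI) (rule refl)
  then have "poly (map_poly of_rat (k - h)) \<zeta> = 0" by (simp add: of_rat_poly_hom.hom_minus)
  then have "poly (map_poly of_rat (k - h)) (\<zeta> ^ t) = 0"
    by (rule rat_poly_root_conjugate[OF p zeta _ assms])
  then show ?thesis by (simp add: conj_map_def k_def of_rat_poly_hom.hom_minus)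
qed

lemma conj_map_in: "conj_map \<zeta> t x \<in> rat_adjoin \<zeta>"
  unfolding conj_map_def poly_altdef
  by (simp, intro subring_closed[OF is_subring_rat_adjoin] of_rat_in_rat_adjoin generator_in_rat_adjoin)

context
  fixes t assumes t: "\<not> p dvd t"
begin

lemma conj_map_add_mult:
  assumes "x \<in> rat_adjoin \<zeta>" "y \<in> rat_adjoin \<zeta>"
  shows "conj_map \<zeta> t (x + y) = conj_map \<zeta> t x + conj_map \<zeta> t y"
    and "conj_map \<zeta> t (x * y) = conj_map \<zeta> t x * conj_map \<zeta> t y"
proof -
  from assms obtain f g where fg: "x = poly (map_poly of_rat f) \<zeta>" "y = poly (map_poly of_rat g) \<zeta>"
    by (auto simp: rat_adjoin_def)
  show "conj_map \<zeta> t (x + y) = conj_map \<zeta> t x + conj_map \<zeta> t y"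
    using conj_map_poly[OF t, of "f + g"] conj_map_poly[OF t, of f] conj_map_poly[OF t, of g]
    by (simp add: fg of_rat_poly_hom.hom_add)
  show "conj_map \<zeta> t (x * y) = conj_map \<zeta> t x * conj_map \<zeta> t y"
    using conj_map_poly[OF t, of "f * g"] conj_map_poly[OF t, of f] conj_map_poly[OF t, of g]
    by (simp add: fg of_rat_poly_hom.hom_mult)
qed

lemma conj_map_of_rat: "conj_map \<zeta> t (of_rat c) = of_rat c"
  using conj_map_poly[OF t, of "[:c:]"] by (simp add: of_rat_hom.map_poly_pCons_hom)

lemma conj_map_of_int: "conj_map \<zeta> t (of_int c) = of_int c"
  using conj_map_of_rat[of "of_int c"] by simp

lemma conj_map_of_nat: "conj_map \<zeta> t (of_nat c) = of_nat c"
  using conj_map_of_rat[of "of_nat c"] by simp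

lemma conj_map_zeta_power: "conj_map \<zeta> t (\<zeta> ^ k) = \<zeta> ^ (t * k)"
  using conj_map_poly[OF t, of "monom 1 k"] by (simp add: map_poly_monom poly_monom power_mult)

lemma conj_map_sum:
  "finite I \<Longrightarrow> (\<And>i. i \<in> I \<Longrightarrow> f i \<in> rat_adjoin \<zeta>) \<Longrightarrow>
    conj_map \<zeta> t (\<Sum>i\<in>I. f i) = (\<Sum>i\<in>I. conj_map \<zeta> t (f i))"
proof (induction I rule: finite_induct)
  case empty
  then show ?case using conj_map_of_nat[of 0] by simp
next
  case (insert i I)
  then show ?case
    using conj_map_add_mult(1)[of "f i" "\<Sum>i\<in>I. f i"] subring_sum[OF is_subring_rat_adjoin, of I f \<zeta>]
    by simp
qed

lemma conj_map_of_int_poly: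
  "x \<in> rat_adjoin \<zeta> \<Longrightarrow> conj_map \<zeta> t (poly (map_poly of_int h) x) = poly (map_poly of_int h) (conj_map \<zeta> t x)"
proof (induction h)
  case 0
  then show ?case using conj_map_of_nat[of 0] by simp
next
  case (pCons a h)
  note cl = subring_closed[OF is_subring_rat_adjoin[of \<zeta>]]
  show ?case
    using pCons by (simp add: of_int_hom.map_poly_pCons_hom conj_map_add_mult cl conj_map_of_int)
qed

text \<open>Conjugation fixes integer coefficients, so a monic integral equation of \<open>x\<close>
  also holds for its conjugate.\<close>

lemma conj_map_algebraic_integer:
  assumes "x \<in> rat_adjoin \<zeta>" "algebraic_integer x"
  shows "algebraic_integer (conj_map \<zeta> t x)"
  using assms conj_map_of_int_poly[OF assms(1)] conj_map_of_nat[of 0]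
  unfolding algebraic_integer_def by (metis of_nat_0)

text \<open>Substituting X ^ u into a polynomial for \<open>x\<close> gives a polynomial for the
  inner conjugate, and both sides become evaluation at \<open>\<zeta> ^ (t * u)\<close>.\<close>

lemma conj_map_comp:
  assumes x: "x \<in> rat_adjoin \<zeta>" and u: "\<not> p dvd u"
  shows "conj_map \<zeta> t (conj_map \<zeta> u x) = conj_map \<zeta> (t * u) x"
proof -
  have tu: "\<not> p dvd t * u" using t u p by (simp add: prime_dvd_mult_iff)
  from x obtain h where h: "x = poly (map_poly of_rat h) \<zeta>" by (auto simp: rat_adjoin_def)
  have "conj_map \<zeta> t (conj_map \<zeta> u x) = conj_map \<zeta> t (poly (map_poly of_rat (pcompose h (monom 1 u))) \<zeta>)"
    by (simp add: h conj_map_poly[OF u] poly_of_rat_pcompose map_poly_monom poly_monom)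
  also have "\<dots> = poly (map_poly of_rat h) ((\<zeta> ^ t) ^ u)"
    by (subst conj_map_poly[OF t]) (simp add: poly_of_rat_pcompose map_poly_monom poly_monom)
  also have "\<dots> = conj_map \<zeta> (t * u) x" by (simp add: h conj_map_poly[OF tu] power_mult)
  finally show ?thesis .
qed

end

lemma conj_map_1:
  assumes "x \<in> rat_adjoin \<zeta>"
  shows "conj_map \<zeta> 1 x = x"
  using assms conj_map_poly[of 1] prime_gt_1_nat[OF p] by (auto simp: rat_adjoin_def)

context
  fixes g assumes g: "residue_primroot p g"
begin

lemma primroot_power_not_dvd: "\<not> p dvd g ^ j"
proof -
  have "coprime p g" using g by (simp add: residue_primroot_def)
  then have "\<not> p dvd g" using p by (metis coprime_absorb_left not_prime_unit)
  then show ?thesis using p prime_dvd_power by blast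
qed

lemma primroot_power_cong: "[j = k] (mod (p - 1)) \<Longrightarrow> \<zeta> ^ (g ^ j) = \<zeta> ^ (g ^ k)"
proof -
  assume jk: "[j = k] (mod (p - 1))"
  have "ord p g = p - 1" "coprime p g"
    using g totient_prime[OF p] by (auto simp: residue_primroot_def)
  then have "[g ^ j = g ^ k] (mod p)" using order_divides_expdiff[of p g j k] jk by simp
  then show ?thesis by (rule power_mod_root_of_unity[OF zeta_pow_p[OF p zeta]])
qed

lemmas primroot_conj_add = conj_map_add_mult(1)[OF primroot_power_not_dvd, folded primroot_conj_def]
lemmas primroot_conj_mult = conj_map_add_mult(2)[OF primroot_power_not_dvd, folded primroot_conj_def]
lemmas primroot_conj_of_rat = conj_map_of_rat[OF primroot_power_not_dvd, folded primroot_conj_def]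
lemmas primroot_conj_sum = conj_map_sum[OF primroot_power_not_dvd, folded primroot_conj_def]

lemma primroot_conj_in: "primroot_conj \<zeta> g j x \<in> rat_adjoin \<zeta>"
  by (simp add: primroot_conj_def conj_map_in)

lemma primroot_conj_sig: "x \<in> rat_adjoin \<zeta> \<Longrightarrow> primroot_conj \<zeta> g j (primroot_conj \<zeta> g k x) = primroot_conj \<zeta> g (j + k) x"
  by (simp add: primroot_conj_def conj_map_comp primroot_power_not_dvd power_add)

lemma primroot_conj_cong: "[j = k] (mod (p - 1)) \<Longrightarrow> primroot_conj \<zeta> g j x = primroot_conj \<zeta> g k x"
  unfolding primroot_conj_def by (rule conj_map_cong) (rule primroot_power_cong)

lemma primroot_conj_0: "x \<in> rat_adjoin \<zeta> \<Longrightarrow> primroot_conj \<zeta> g 0 x = x"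
  using conj_map_1 by (simp add: primroot_conj_def)

lemma primroot_conj_zeta_power: "primroot_conj \<zeta> g j (\<zeta> ^ (g ^ k)) = \<zeta> ^ (g ^ (j + k))"
  by (simp add: primroot_conj_def conj_map_zeta_power[OF primroot_power_not_dvd] power_add)

section \<open>Gaussian periods and the Galois correspondence\<close>

text \<open>The vanishing sum of all powers of \<zeta> trades \<open>\<zeta> ^ 0\<close> for the
  others, and the powers of the primitive root run through the remaining exponents. In this form
  \<sigma> merely shifts the index j.\<close>

lemma rat_adjoin_normal_basis:
  assumes "y \<in> rat_adjoin \<zeta>"
  shows "\<exists>d. y = (\<Sum>j<p - 1. of_rat (d j) * \<zeta> ^ (g ^ j))"
proof -
  have p0: "p > 0" using p prime_gt_0_nat by blast
  obtain c where c: "y = (\<Sum>k<p. of_rat (c k) * \<zeta> ^ k)"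
    using rat_adjoin_root_of_unity_span[OF zeta_pow_p[OF p zeta] p0 assms] by blast
  have ins: "{..<p} = insert 0 {0<..<p}" using p0 by auto
  have "\<not> p dvd 1" using p by auto
  then have "(\<Sum>k<p. \<zeta> ^ k) = 0" using sum_powers_root_of_unity_eq_0[OF p zeta, of 1] by simp
  then have one: "1 = - (\<Sum>k\<in>{0<..<p}. \<zeta> ^ k)" unfolding ins by (simp add: eq_neg_iff_add_eq_0)
  have tot: "totatives p = {0<..<p}" using p by (simp add: totatives_prime)
  have "y = of_rat (c 0) * 1 + (\<Sum>k\<in>{0<..<p}. of_rat (c k) * \<zeta> ^ k)"
    unfolding c ins by simp
  also have "\<dots> = (\<Sum>k\<in>{0<..<p}. of_rat (c k - c 0) * \<zeta> ^ k)"
    by (subst one) (simp add: sum_distrib_left sum_subtractf of_rat_diff left_diff_distrib)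
  also have "\<dots> = (\<Sum>j<p - 1. of_rat (c (g ^ j mod p) - c 0) * \<zeta> ^ (g ^ j mod p))"
    using sum.reindex_bij_betw[OF residue_primroot_is_generator[OF _ g], of "\<lambda>k. of_rat (c k - c 0) * \<zeta> ^ k"]
      p prime_gt_1_nat[OF p] by (simp add: tot totient_prime)
  also have "\<dots> = (\<Sum>j<p - 1. of_rat (c (g ^ j mod p) - c 0) * \<zeta> ^ (g ^ j))"
  proof (rule sum.cong)
    fix j
    have "\<zeta> ^ (g ^ j mod p) = \<zeta> ^ (g ^ j)"
      by (rule power_mod_root_of_unity[OF zeta_pow_p[OF p zeta]]) (simp add: cong_def)
    then show "of_rat (c (g ^ j mod p) - c 0) * \<zeta> ^ (g ^ j mod p) = of_rat (c (g ^ j mod p) - c 0) * \<zeta> ^ (g ^ j)"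
      by simp
  qed simp
  finally show ?thesis by (rule exI[of _ "\<lambda>j. c (g ^ j mod p) - c 0"])
qed

lemma period_shift:
  assumes "e dvd p - 1"
  shows "period p \<zeta> g e (e + j) = period p \<zeta> g e j"
proof -
  define m where "m = (p - 1) div e"
  have em: "e * m = p - 1" using assms by (simp add: m_def)
  \<comment> \<open>The sum with one term too many is split once at the front and once at the
    back.\<close>
  have "period p \<zeta> g e (e + j) + \<zeta> ^ (g ^ (e * 0 + j)) = (\<Sum>i<Suc m. \<zeta> ^ (g ^ (e * i + j)))"
    unfolding period_def m_def[symmetric] sum.lessThan_Suc_shift
    by (simp add: algebra_simps)
  also have "\<dots> = period p \<zeta> g e j + \<zeta> ^ (g ^ (e * m + j))"
    unfolding period_def m_def[symmetric] by simp
  also have "\<zeta> ^ (g ^ (e * m + j)) = \<zeta> ^ (g ^ (e * 0 + j))"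
    by (rule primroot_power_cong) (simp add: em cong_def)
  finally show ?thesis by simp
qed

lemma period_mod:
  assumes "e dvd p - 1"
  shows "period p \<zeta> g e j = period p \<zeta> g e (j mod e)"
proof -
  have "period p \<zeta> g e (e * k + r) = period p \<zeta> g e r" for k r
    by (induction k) (simp_all add: period_shift[OF assms] add.assoc)
  from this[of "j div e" "j mod e"] show ?thesis by simp
qed

text \<open>Averaging over the orbit of \<sigma> ^ e: adding the m = (p - 1) / e equal elements
  \<sigma> ^ (e i) y turns each power of \<zeta> into a period, and periods depend on j only modulo
  e. Dividing by m recovers y.\<close>

lemma fixed_field_spanned_by_periods:
  assumes e: "e dvd p - 1" and y: "y \<in> rat_adjoin \<zeta>" "primroot_conj \<zeta> g e y = y"
  shows "\<exists>c. y = (\<Sum>r<e. of_rat (c r) * period p \<zeta> g e r)"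
proof -
  note cl = subring_closed[OF is_subring_rat_adjoin[of \<zeta>]] of_rat_in_rat_adjoin generator_in_rat_adjoin
  define m where "m = (p - 1) div e"
  have em: "e * m = p - 1" using e by (simp add: m_def)
  have p1: "p - 1 > 0" using prime_gt_1_nat[OF p] by simp
  then have em0: "e > 0" "m > 0" using em by (metis gr0I mult_is_0 less_irrefl)+
  have fixed: "primroot_conj \<zeta> g (e * i) y = y" for i
  proof (induction i)
    case (Suc i)
    have "primroot_conj \<zeta> g (e * Suc i) y = primroot_conj \<zeta> g e (primroot_conj \<zeta> g (e * i) y)" using y(1) by (simp add: primroot_conj_sig)
    then show ?case using Suc y(2) by simp
  qed (simp add: primroot_conj_0 y)
  obtain d where d: "y = (\<Sum>j<p - 1. of_rat (d j) * \<zeta> ^ (g ^ j))"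
    using rat_adjoin_normal_basis[OF y(1)] by blast
  have "primroot_conj \<zeta> g (e * i) y = (\<Sum>j<p - 1. of_rat (d j) * \<zeta> ^ (g ^ (e * i + j)))" for i
    unfolding d by (subst primroot_conj_sum) (auto intro!: cl sum.cong simp: primroot_conj_mult cl primroot_conj_of_rat primroot_conj_zeta_power)
  then have "y = (\<Sum>j<p - 1. of_rat (d j) * \<zeta> ^ (g ^ (e * i + j)))" for i using fixed by simp
  then have "(\<Sum>i<m. y) = (\<Sum>i<m. \<Sum>j<p - 1. of_rat (d j) * \<zeta> ^ (g ^ (e * i + j)))"
    by (intro sum.cong) auto
  also have "\<dots> = (\<Sum>j<p - 1. of_rat (d j) * period p \<zeta> g e j)"
    by (subst sum.swap) (simp add: period_def m_def sum_distrib_left)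
  also have "\<dots> = (\<Sum>j<p - 1. of_rat (d j) * period p \<zeta> g e (j mod e))"
    by (subst period_mod[OF e]) simp
  also have "\<dots> = (\<Sum>r<e. \<Sum>j\<in>{j \<in> {..<p - 1}. j mod e = r}. of_rat (d j) * period p \<zeta> g e (j mod e))"
    by (rule sum.group[symmetric]) (use em0 in auto)
  also have "\<dots> = (\<Sum>r<e. of_rat (\<Sum>j\<in>{j \<in> {..<p - 1}. j mod e = r}. d j) * period p \<zeta> g e r)"
    by (intro sum.cong) (auto simp: of_rat_sum sum_distrib_right)
  finally have my: "of_nat m * y = (\<Sum>r<e. of_rat (\<Sum>j\<in>{j \<in> {..<p - 1}. j mod e = r}. d j) * period p \<zeta> g e r)"
    by simp
  define D where "D r = (\<Sum>j\<in>{j \<in> {..<p - 1}. j mod e = r}. d j)" for r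
  have "y = (\<Sum>r<e. of_rat (D r) * period p \<zeta> g e r) / of_nat m"
    unfolding D_def my[symmetric] using em0 by simp
  also have "\<dots> = (\<Sum>r<e. of_rat (D r / of_nat m) * period p \<zeta> g e r)"
    by (simp add: sum_divide_distrib of_rat_divide)
  finally show ?thesis by (rule exI[of _ "\<lambda>r. D r / of_nat m"])
qed

text \<open>The least e > 0 such that \<open>\<sigma> ^ e\<close> fixes K is n: independence of characters gives
  \<open>e \<le> n\<close>, and \<open>n \<le> e\<close> because K lies in the field fixed by \<open>\<sigma> ^ e\<close>, which is spanned by e periods.\<close>

lemma subfield_galois:
  assumes K: "subfield K" "K \<subseteq> rat_adjoin \<zeta>" "degree_over_Q K n"
  shows "n > 0"
    and "\<And>x. x \<in> K \<Longrightarrow> primroot_conj \<zeta> g n x = x"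
    and "\<And>y. y \<in> rat_adjoin \<zeta> \<Longrightarrow> primroot_conj \<zeta> g n y = y \<Longrightarrow> y \<in> K"
    and "\<And>\<phi>. is_aut K \<rat> \<phi> \<Longrightarrow> \<exists>j. \<forall>x\<in>K. \<phi> x = primroot_conj \<zeta> g j x"
proof -
  have KM: "x \<in> K \<Longrightarrow> x \<in> rat_adjoin \<zeta>" for x using K by auto
  note clK = subring_closed[OF subfield_is_subring[OF K(1)]]
  have p1: "p - 1 > 0" using prime_gt_1_nat[OF p] by simp
  have primroot_conj_p1: "primroot_conj \<zeta> g (p - 1) x = x" if "x \<in> rat_adjoin \<zeta>" for x
    using primroot_conj_cong[of "p - 1" 0 x] primroot_conj_0[OF that] by (simp add: cong_def)
  define good where "good = (\<lambda>e. e > 0 \<and> (\<forall>x\<in>K. primroot_conj \<zeta> g e x = x))"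
  define e where "e = (LEAST e. good e)"
  have "good (p - 1)" using p1 primroot_conj_p1 KM by (simp add: good_def)
  then have "good e" and e_le: "e \<le> p - 1" unfolding e_def by (auto intro: LeastI Least_le)
  then have e0: "e > 0" and fixed: "\<And>x. x \<in> K \<Longrightarrow> primroot_conj \<zeta> g e x = x" by (auto simp: good_def)
  have min: "\<not> good j" if "j < e" for j using that not_less_Least unfolding e_def by blast
  have fixm: "primroot_conj \<zeta> g (e * i) x = x" if "x \<in> K" for i x
  proof (induction i)
    case (Suc i)
    have "primroot_conj \<zeta> g (e * Suc i) x = primroot_conj \<zeta> g e (primroot_conj \<zeta> g (e * i) x)" using that KM by (simp add: primroot_conj_sig)
    then show ?case using Suc fixed that by simp
  qed (simp add: primroot_conj_0 KM that)
  have e_dvd: "e dvd p - 1"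
  proof (rule ccontr)
    assume "\<not> e dvd p - 1"
    then have r0: "(p - 1) mod e > 0" by (simp add: mod_greater_zero_iff_not_dvd)
    have "primroot_conj \<zeta> g ((p - 1) mod e) x = x" if "x \<in> K" for x
    proof -
      have "x = primroot_conj \<zeta> g ((p - 1) mod e + e * ((p - 1) div e)) x" using primroot_conj_p1 KM that by simp
      also have "\<dots> = primroot_conj \<zeta> g ((p - 1) mod e) (primroot_conj \<zeta> g (e * ((p - 1) div e)) x)" using KM that by (simp only: primroot_conj_sig)
      also have "\<dots> = primroot_conj \<zeta> g ((p - 1) mod e) x" using fixm that by simp
      finally show ?thesis by simp
    qed
    then have "good ((p - 1) mod e)" using r0 by (simp add: good_def)
    then show False using min e0 mod_less_divisor by blast
  qed
  have dist: "\<exists>x\<in>K. primroot_conj \<zeta> g j x \<noteq> primroot_conj \<zeta> g k x" if jk: "j < k" "k < e" for j k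
  proof (rule ccontr)
    assume "\<not> ?thesis"
    then have eq: "primroot_conj \<zeta> g j x = primroot_conj \<zeta> g k x" if "x \<in> K" for x using that by auto
    have "primroot_conj \<zeta> g (k - j) x = x" if x: "x \<in> K" for x
    proof -
      \<comment> \<open>The exponent p - 1 - j plays the role of -j while staying a natural
        number.\<close>
      have "x = primroot_conj \<zeta> g (p - 1 - j + j) x" using primroot_conj_p1 KM x jk e_le by simp
      also have "\<dots> = primroot_conj \<zeta> g (p - 1 - j) (primroot_conj \<zeta> g k x)" using eq[OF x] primroot_conj_sig[OF KM[OF x], of "p - 1 - j" j] by simp
      also have "\<dots> = primroot_conj \<zeta> g (p - 1 - j + k) x" by (rule primroot_conj_sig[OF KM[OF x]])
      also have "p - 1 - j + k = (k - j) + (p - 1)" using jk e_le by simp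
      also have "primroot_conj \<zeta> g \<dots> x = primroot_conj \<zeta> g (k - j) x" by (rule primroot_conj_cong) (simp only: cong_def mod_add_self2)
      finally show ?thesis by simp
    qed
    then have "good (k - j)" using jk by (simp add: good_def)
    then show False using min jk by auto
  qed
  have dist': "\<exists>x\<in>K. primroot_conj \<zeta> g j x \<noteq> primroot_conj \<zeta> g k x" if "j < e" "k < e" "j \<noteq> k" for j k
    using dist[of j k] dist[of k j] that by (metis linorder_neqE_nat)
  have "card {..<e} \<le> n"
    by (rule card_characters_le_degree[OF _ K(1,3), where \<phi> = "primroot_conj \<zeta> g"])
       (use dist' KM in \<open>auto simp: primroot_conj_add primroot_conj_mult primroot_conj_of_rat\<close>)
  then have en: "e \<le> n" by simp
  from K(3) obtain B where B: "finite B" "card B = n" "B \<subseteq> K"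
    "\<And>c :: complex \<Rightarrow> rat. (\<Sum>b\<in>B. of_rat (c b) * b) = 0 \<Longrightarrow> \<forall>b\<in>B. c b = 0"
    unfolding degree_over_Q_def by blast
  have span: "\<exists>c. y = (\<Sum>r<e. of_rat (c r) * period p \<zeta> g e r)" if "y \<in> rat_adjoin \<zeta>" "primroot_conj \<zeta> g e y = y" for y
    by (rule fixed_field_spanned_by_periods[OF e_dvd that])
  have dep: "\<exists>x. (\<exists>i\<in>I. x i \<noteq> 0) \<and> (\<Sum>i\<in>I. of_rat (x i) * i) = 0"
    if I: "finite I" "e < card I" "\<And>y. y \<in> I \<Longrightarrow> y \<in> rat_adjoin \<zeta> \<and> primroot_conj \<zeta> g e y = y" for I
  proof -
    have "\<forall>y\<in>I. \<exists>c. y = (\<Sum>r<e. of_rat (c r) * period p \<zeta> g e r)" using span I(3) by blast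
    then obtain C where "\<forall>y\<in>I. y = (\<Sum>r<e. of_rat (C y r) * period p \<zeta> g e r)" by metis
    then show ?thesis
      using rat_span_dependent[OF I(1), of "{..<e}" "\<lambda>y. y" C "period p \<zeta> g e"] I(2) by simp
  qed
  have "n \<le> e"
  proof (rule ccontr)
    assume "\<not> n \<le> e"
    then obtain x where "\<exists>i\<in>B. x i \<noteq> 0" "(\<Sum>i\<in>B. of_rat (x i) * i) = 0"
      using dep[OF B(1)] B(2,3) KM fixed by (metis not_le_imp_less subsetD)
    then show False using B(4)[of x] by blast
  qed
  with en have ne: "n = e" by simp
  show "n > 0" using e0 ne by simp
  show "\<And>x. x \<in> K \<Longrightarrow> primroot_conj \<zeta> g n x = x" using fixed ne by simp
  \<comment> \<open>Together with the basis \<open>B\<close>, a fixed \<open>y\<close> outside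
    \<open>K\<close> would be n + 1 elements in a space spanned by n periods. Since \<open>B\<close>
    is independent, the relation involves \<open>y\<close> and solves for it in
    \<open>K\<close>.\<close>
  show "y \<in> K" if y: "y \<in> rat_adjoin \<zeta>" "primroot_conj \<zeta> g n y = y" for y
  proof (rule ccontr)
    assume yK: "y \<notin> K"
    then have yB: "y \<notin> B" using B by auto
    obtain x where x: "\<exists>i\<in>insert y B. x i \<noteq> 0" "(\<Sum>i\<in>insert y B. of_rat (x i) * i) = 0"
    proof -
      have "e < card (insert y B)" using B yB ne by simp
      moreover have "v \<in> rat_adjoin \<zeta> \<and> primroot_conj \<zeta> g e v = v" if "v \<in> insert y B" for v
        using that y ne B(3) KM fixed by auto
      ultimately show ?thesis using dep[of "insert y B"] B(1) that by blast
    qed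
    have eq: "of_rat (x y) * y + (\<Sum>i\<in>B. of_rat (x i) * i) = 0" using x(2) yB B(1) by simp
    show False
    proof (cases "x y = 0")
      case True
      then show False using eq x(1) B(4)[of x] by auto
    next
      case False
      have "of_rat (x y) * y = - (\<Sum>i\<in>B. of_rat (x i) * i)" using eq by (metis eq_neg_iff_add_eq_0)
      then have "y = - (\<Sum>i\<in>B. of_rat (x i) * i) / of_rat (x y)"
        using False by (metis nonzero_mult_div_cancel_left of_rat_eq_0_iff)
      also have "\<dots> \<in> K"
        by (intro subfield_divide[OF K(1)] clK subfield_of_rat[OF K(1)]) (use B in auto)
      finally show False using yK by simp
    qed
  qed
  show "\<exists>j. \<forall>x\<in>K. \<phi> x = primroot_conj \<zeta> g j x" if \<phi>: "is_aut K \<rat> \<phi>" for \<phi>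
  proof (rule ccontr)
    assume no: "\<not> ?thesis"
    \<comment> \<open>If \<phi> agreed with no power of \<sigma> on \<open>K\<close>, it could be
      added at index e to the e distinct powers, giving n + 1 characters.\<close>
    have "card {..e} \<le> n"
    proof (rule card_characters_le_degree[OF _ K(1,3), where \<phi> = "\<lambda>j. if j < e then primroot_conj \<zeta> g j else \<phi>"])
      fix i j assume "i \<in> {..e}" "j \<in> {..e}" "i \<noteq> j"
      then consider "i < e" "j < e" | "i < e" "\<not> j < e" | "\<not> i < e" "j < e" by force
      then show "\<exists>x\<in>K. (if i < e then primroot_conj \<zeta> g i else \<phi>) x \<noteq> (if j < e then primroot_conj \<zeta> g j else \<phi>) x"
      proof cases
        case 1
        then show ?thesis using dist' \<open>i \<noteq> j\<close> by simp
      next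
        case 2
        moreover obtain x where "x \<in> K" "\<phi> x \<noteq> primroot_conj \<zeta> g i x" using no by blast
        ultimately show ?thesis by (intro bexI[of _ x]) auto
      next
        case 3
        moreover obtain x where "x \<in> K" "\<phi> x \<noteq> primroot_conj \<zeta> g j x" using no by blast
        ultimately show ?thesis by (intro bexI[of _ x]) auto
      qed
    qed (use \<phi> KM in \<open>auto simp: primroot_conj_add primroot_conj_mult primroot_conj_of_rat is_aut_def\<close>)
    then show False using ne by simp
  qed
qed

end

end

section \<open>Frobenius elements in subfields of the p-th cyclotomic field\<close>

lemma subfield_Rats: "subfield K \<Longrightarrow> \<rat> \<subseteq> K"
  using subfield_of_rat by (auto elim: Rats_cases)

text \<open>Serves for iterates such as \<open>primroot_conj \<zeta> g b ^^ a\<close>, which are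
  compared with a single conjugation only on \<open>K\<close>.\<close>

lemma is_aut_cong:
  assumes K: "subfield K" and aut: "is_aut K \<rat> f" and eq: "\<And>x. x \<in> K \<Longrightarrow> h x = f x"
  shows "is_aut K \<rat> h"
proof -
  note cl = subring_closed[OF subfield_is_subring[OF K]]
  have "bij_betw h K K \<longleftrightarrow> bij_betw f K K" by (rule bij_betw_cong) (rule eq)
  then show ?thesis using aut subfield_Rats[OF K] unfolding is_aut_def by (auto simp: eq cl subset_eq)
qed

context
  fixes p :: nat and \<zeta> :: complex and g :: nat and K :: "complex set" and n :: nat
  assumes p: "prime p" and zeta: "primitive_root p \<zeta>" and g: "residue_primroot p g"
    and K: "subfield K" "K \<subseteq> rat_adjoin \<zeta>" "degree_over_Q K n"
begin

lemma K_in: "x \<in> K \<Longrightarrow> x \<in> rat_adjoin \<zeta>"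
  using K by auto

lemmas galois_facts = subfield_galois[OF p zeta g K]

text \<open>\<open>K\<close> is the field fixed by \<sigma> ^ n, and \<sigma> ^ j commutes with
  \<sigma> ^ n.\<close>

lemma primroot_conj_closed: "x \<in> K \<Longrightarrow> primroot_conj \<zeta> g j x \<in> K"
proof (rule galois_facts(3))
  assume x: "x \<in> K"
  show "primroot_conj \<zeta> g j x \<in> rat_adjoin \<zeta>" by (rule primroot_conj_in[OF p zeta g])
  have "primroot_conj \<zeta> g n (primroot_conj \<zeta> g j x) = primroot_conj \<zeta> g (n + j) x" by (rule primroot_conj_sig[OF p zeta g K_in[OF x]])
  also have "\<dots> = primroot_conj \<zeta> g j (primroot_conj \<zeta> g n x)" using primroot_conj_sig[OF p zeta g K_in[OF x], of j n] by (simp add: add.commute)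
  also have "\<dots> = primroot_conj \<zeta> g j x" using galois_facts(2)[OF x] by simp
  finally show "primroot_conj \<zeta> g n (primroot_conj \<zeta> g j x) = primroot_conj \<zeta> g j x" .
qed

lemma primroot_conj_mult_n: "x \<in> K \<Longrightarrow> primroot_conj \<zeta> g (n * k) x = x"
proof (induction k)
  case 0
  then show ?case using primroot_conj_0[OF p zeta g K_in] by simp
next
  case (Suc k)
  have "primroot_conj \<zeta> g (n * Suc k) x = primroot_conj \<zeta> g n (primroot_conj \<zeta> g (n * k) x)"
    using primroot_conj_sig[OF p zeta g K_in[OF Suc.prems], of n "n * k"] by simp
  then show ?case using Suc galois_facts(2) by simp
qed

lemma primroot_conj_cong_n:
  assumes "x \<in> K" "[j = k] (mod n)"
  shows "primroot_conj \<zeta> g j x = primroot_conj \<zeta> g k x"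
proof -
  have "primroot_conj \<zeta> g j x = primroot_conj \<zeta> g (j mod n) x" for j
    using primroot_conj_sig[OF p zeta g K_in[OF assms(1)], of "j mod n" "n * (j div n)"] primroot_conj_mult_n[OF assms(1)]
    by simp
  then show ?thesis using assms(2) by (metis cong_def)
qed

lemma primroot_conj_funpow: "x \<in> K \<Longrightarrow> (primroot_conj \<zeta> g b ^^ k) x = primroot_conj \<zeta> g (b * k) x"
proof (induction k)
  case 0
  then show ?case using primroot_conj_0[OF p zeta g K_in] by simp
next
  case (Suc k)
  then show ?case using primroot_conj_sig[OF p zeta g K_in] by simp
qed

lemma is_aut_primroot_conj: "is_aut K \<rat> (primroot_conj \<zeta> g j)"
proof -
  \<comment> \<open>The inverse of \<sigma> ^ j on \<open>K\<close> is \<sigma> ^ (j (n - 1)),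
    because \<sigma> ^ (n j) is trivial there.\<close>
  have inv: "primroot_conj \<zeta> g (j * (n - 1)) (primroot_conj \<zeta> g j x) = x" "primroot_conj \<zeta> g j (primroot_conj \<zeta> g (j * (n - 1)) x) = x"
    if x: "x \<in> K" for x
  proof -
    have "j * (n - 1) + j = n * j" using galois_facts(1) by (metis Suc_diff_1 add.commute mult.commute mult_Suc_right)
    then show "primroot_conj \<zeta> g (j * (n - 1)) (primroot_conj \<zeta> g j x) = x" "primroot_conj \<zeta> g j (primroot_conj \<zeta> g (j * (n - 1)) x) = x"
      using primroot_conj_sig[OF p zeta g K_in[OF x]] primroot_conj_mult_n[OF x] by (simp_all add: add.commute)
  qed
  have "bij_betw (primroot_conj \<zeta> g j) K K"
    by (rule bij_betw_byWitness[where f' = "primroot_conj \<zeta> g (j * (n - 1))"]) (use inv in \<open>auto simp del: One_nat_def simp: primroot_conj_closed\<close>)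
  then show ?thesis unfolding is_aut_def
    using primroot_conj_add[OF p zeta g K_in K_in] primroot_conj_mult[OF p zeta g K_in K_in] primroot_conj_of_rat[OF p zeta g]
    by (auto elim!: Rats_cases)
qed

text \<open>Every automorphism of \<open>K\<close> is some \<sigma> ^ j on \<open>K\<close>, and
  multiplying j by an inverse of \<open>b\<close> modulo \<open>n\<close> writes it as a power of
  \<sigma> ^ b.\<close>

lemma gal_generator_primroot_conj:
  assumes "coprime b n"
  shows "gal_generator K \<rat> (primroot_conj \<zeta> g b)"
  unfolding gal_generator_def
proof (intro conjI allI impI is_aut_primroot_conj)
  fix \<phi> assume "is_aut K \<rat> \<phi>"
  then obtain j where j: "\<forall>x\<in>K. \<phi> x = primroot_conj \<zeta> g j x" using galois_facts(4) by blast
  obtain k where "[b * k = 1] (mod n)" using cong_solve_coprime_nat[OF assms] by auto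
  then have "[b * (k * j) = j] (mod n)" using cong_scalar_right[of "b * k" 1 n j] by (simp add: mult.assoc)
  then have "\<forall>x\<in>K. \<phi> x = (primroot_conj \<zeta> g b ^^ (k * j)) x" using j primroot_conj_funpow primroot_conj_cong_n by simp
  then show "\<exists>k. \<forall>x\<in>K. \<phi> x = (primroot_conj \<zeta> g b ^^ k) x" by blast
qed

text \<open>On \<int>[\<zeta>] the l-th power is \<zeta> \<mapsto> \<zeta> ^ l modulo l. For a
  general integer x of \<open>K\<close> this is applied to m x with m prime to l; since m ^ l and m
  agree modulo l, the difference sought lies in \<open>Q\<close> after multiplication by m, and m is
  not in \<open>Q\<close>.\<close>

lemma frobenius_congruence:
  assumes l: "prime l" "l \<noteq> p"
    and Q: "prime_ideal_of (ring_of_integers K) Q" "of_nat l \<in> Q"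
    and x: "x \<in> ring_of_integers K" and \<sigma>: "conj_map \<zeta> l x \<in> K"
  shows "conj_map \<zeta> l x - x ^ l \<in> Q"
proof -
  have R: "is_subring (ring_of_integers K)" by (rule is_subring_ring_of_integers[OF K(1)])
  note clK = subring_closed[OF subfield_is_subring[OF K(1)]]
  note clI = subring_closed[OF is_subring_algebraic_integer, unfolded mem_Collect_eq]
  have lp: "\<not> p dvd l" using l p by (metis primes_dvd_imp_eq)
  have cop: "coprime l p" using l p by (simp add: primes_coprime)
  have xK: "x \<in> K" "algebraic_integer x" using x by (auto simp: ring_of_integers_def)
  obtain m where m: "coprime m l" "of_nat m * x \<in> int_adjoin \<zeta>"
    using algebraic_integer_denominator_coprime[OF zeta_pow_p[OF p zeta] l(1) cop xK(2) K_in[OF xK(1)]] by blast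
  then obtain h where h: "of_nat m * x = poly (map_poly of_int h) \<zeta>" by (auto simp: int_adjoin_def)
  define c where "c = conj_map \<zeta> l x"
  have "conj_map \<zeta> l (of_nat m * x) = of_nat m * c"
    using conj_map_add_mult(2)[OF p zeta lp subring_of_nat[OF is_subring_rat_adjoin] K_in[OF xK(1)]]
    by (simp add: c_def conj_map_of_nat[OF p zeta lp])
  moreover have "conj_map \<zeta> l (of_nat m * x) = poly (map_poly of_int h) (\<zeta> ^ l)"
    using conj_map_of_int_poly[OF p zeta lp generator_in_rat_adjoin, of h]
      conj_map_zeta_power[OF p zeta lp, of 1] by (simp add: h)
  ultimately have mc: "of_nat m * c = poly (map_poly of_int h) (\<zeta> ^ l)" by simp
  obtain w where w: "w \<in> int_adjoin \<zeta>" "(of_nat m * x) ^ l - of_nat m * c = of_nat l * w"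
    using cong_mod_frobenius[OF is_subring_int_adjoin l(1) generator_in_int_adjoin, of \<zeta> h]
    unfolding cong_mod_def mc h by blast
  obtain k where k: "int m ^ l - int m = int l * k"
    using prime_dvd_power_diff_self[OF l(1), of "int m"] by (elim dvdE)
  then have k': "of_nat m ^ l - of_nat m = (of_nat l * of_int k :: complex)"
    by (metis of_int_diff of_int_mult of_int_of_nat_eq of_int_power)
  define y where "y = c - x ^ l"
  \<comment> \<open>The cofactor \<open>w\<close> is only known to lie in \<int>[\<zeta>]. That
    \<open>u\<close> lies in \<open>K\<close> comes from its being the quotient
    \<open>m y / l\<close>, and then \<open>l u\<close> lies in \<open>Q\<close>.\<close>
  define u where "u = of_int k * x ^ l - w"
  have "of_nat m * y = (of_nat m ^ l - of_nat m) * x ^ l - ((of_nat m * x) ^ l - of_nat m * c)"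
    by (simp add: y_def power_mult_distrib algebra_simps)
  also have "\<dots> = of_nat l * u" unfolding k' w(2) by (simp add: u_def algebra_simps)
  finally have my: "of_nat m * y = of_nat l * u" .
  have l0: "l > 0" using l prime_gt_0_nat by blast
  have yK: "y \<in> K" unfolding y_def c_def by (intro clK \<sigma> xK)
  have "algebraic_integer c"
    unfolding c_def by (rule conj_map_algebraic_integer[OF p zeta lp K_in[OF xK(1)] xK(2)])
  then have "algebraic_integer y" unfolding y_def by (intro clI xK)
  with yK have yR: "y \<in> ring_of_integers K" by (simp add: ring_of_integers_def)
  have "algebraic_integer u" unfolding u_def
    by (intro clI xK int_adjoin_algebraic_integer[OF zeta_algebraic_integer[OF p zeta] w(1)])
  moreover have "u = of_nat m * y / of_nat l" using my l0 by (simp add: field_simps)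
  then have "u \<in> K" using yK clK subfield_divide[OF K(1)] by simp
  ultimately have "u \<in> ring_of_integers K" by (simp add: ring_of_integers_def)
  then have "of_nat m * y \<in> Q" unfolding my by (rule prime_ideal_mult_right[OF R Q(1) _ Q(2)])
  then have "of_nat m \<in> Q \<or> y \<in> Q"
    using prime_ideal_prime[OF R Q(1) subring_of_nat[OF R] yR] by blast
  moreover have "of_nat m \<notin> Q"
    using prime_ideal_of_nat_iff[OF R Q(1) l(1) Q(2)] m(1) l(1)
    by (metis coprime_absorb_right coprime_commute not_prime_unit)
  ultimately show ?thesis by (simp add: y_def c_def)
qed

text \<open>The congruence for l makes \<zeta> \<mapsto> \<zeta> ^ l equal to \<sigma> ^ d, and on
  \<open>K\<close> the exponents d and b a may be exchanged because \<sigma> ^ n is trivial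
  there.\<close>

lemma is_frobenius_primroot_conj_funpow:
  assumes l: "prime l" "l \<noteq> p" and d: "[l = g ^ d] (mod p)" and ba: "[b * a = d] (mod n)"
  shows "is_frobenius_Q K l (primroot_conj \<zeta> g b ^^ a)"
proof -
  have "\<zeta> ^ l = \<zeta> ^ (g ^ d)" by (rule power_mod_root_of_unity[OF zeta_pow_p[OF p zeta] d])
  then have "conj_map \<zeta> l x = primroot_conj \<zeta> g d x" for x unfolding primroot_conj_def by (rule conj_map_cong)
  then have eq: "(primroot_conj \<zeta> g b ^^ a) x = conj_map \<zeta> l x" if "x \<in> K" for x
    using primroot_conj_funpow[OF that, where b = b and k = a] primroot_conj_cong_n[OF that ba] by simp
  have aut: "is_aut K \<rat> (primroot_conj \<zeta> g b ^^ a)"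
    by (rule is_aut_cong[OF K(1) is_aut_primroot_conj[of "b * a"]]) (rule primroot_conj_funpow)
  have "(primroot_conj \<zeta> g b ^^ a) x - x ^ l \<in> Q"
    if "prime_ideal_of (ring_of_integers K) Q" "of_nat l \<in> Q" "x \<in> ring_of_integers K" for Q x
  proof -
    have x: "x \<in> K" using that(3) by (simp add: ring_of_integers_def)
    then have "conj_map \<zeta> l x \<in> K" using primroot_conj_funpow[OF x, where b = b and k = a] primroot_conj_closed eq by simp
    then show ?thesis using frobenius_congruence[OF l that] eq[OF x] by simp
  qed
  then show ?thesis unfolding is_frobenius_Q_def using aut by blast
qed

end

section \<open>Reduction modulo a prime of F above p\<close>

lemma residue_card_eq:
  assumes R: "is_subring R" and P: "prime_ideal_of R P" and p: "prime p" "of_nat p \<in> P"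
    and rep: "\<And>x. x \<in> R \<Longrightarrow> \<exists>i<p. x - of_nat i \<in> P"
  shows "residue_card R P = p"
proof -
  define cls where "cls = (\<lambda>x. {y \<in> R. x - y \<in> P})"
  note clR = subring_closed[OF R]
  have eqI: "cls x = cls y" if "x - y \<in> P" for x y
  proof -
    have "x - z \<in> P \<longleftrightarrow> y - z \<in> P" for z
      using prime_ideal_add[OF R P that, of "y - z"] prime_ideal_diff[OF R P _ that, of "x - z"]
      by (auto simp: algebra_simps)
    then show ?thesis by (simp add: cls_def)
  qed
  have "cls ` R = (\<lambda>i. cls (of_nat i)) ` {..<p}"
  proof
    show "cls ` R \<subseteq> (\<lambda>i. cls (of_nat i)) ` {..<p}" using rep eqI by fastforce
    show "(\<lambda>i. cls (of_nat i)) ` {..<p} \<subseteq> cls ` R" using clR(8) by auto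
  qed
  moreover have "inj_on (\<lambda>i. cls (of_nat i)) {..<p}"
  proof (rule inj_onI)
    fix i j assume ij: "i \<in> {..<p}" "j \<in> {..<p}" "cls (of_nat i) = cls (of_nat j)"
    have "of_nat j \<in> cls (of_nat j)" using clR(8) prime_ideal_0[OF R P] by (simp add: cls_def)
    then have "of_nat j \<in> cls (of_nat i)" by (simp only: ij(3))
    then have "complex_of_nat i - of_nat j \<in> P" by (simp add: cls_def)
    then have "of_int (int i - int j) \<in> P" by simp
    then have "int p dvd int i - int j" using prime_ideal_of_int_iff[OF R P p] by blast
    then have "[int i = int j] (mod int p)" by (simp add: cong_iff_dvd_diff)
    then have "[i = j] (mod p)" by (simp add: cong_int_iff)
    then show "i = j" using ij by (simp add: cong_less_modulus_unique_nat)
  qed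
  ultimately have "card (cls ` R) = p" by (simp add: card_image)
  then show ?thesis by (simp add: residue_card_def cls_def)
qed

lemma prime_ideal_poly_cong:
  assumes R: "is_subring R" and P: "prime_ideal_of R P"
    and xy: "x \<in> R" "y \<in> R" "x - y \<in> P"
  shows "poly (map_poly of_int h) x - poly (map_poly of_int h) y \<in> P"
proof (induction h)
  case 0
  then show ?case by (simp add: prime_ideal_0[OF R P])
next
  case (pCons a h)
  let ?h = "poly (map_poly of_int h)"
  have "x * (?h x - ?h y) + (x - y) * ?h y \<in> P"
    by (intro prime_ideal_add[OF R P] prime_ideal_mult[OF R P] prime_ideal_mult_right[OF R P]
        subring_poly[OF R] xy pCons.IH)
  then show ?case by (simp add: of_int_hom.map_poly_pCons_hom algebra_simps)
qed

lemma prime_ideal_power_cong: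
  assumes R: "is_subring R" and P: "prime_ideal_of R P"
    and xy: "x \<in> R" "y \<in> R" "x - y \<in> P"
  shows "x ^ k - y ^ k \<in> P"
  using prime_ideal_poly_cong[OF assms, of "monom 1 k"] by (simp add: map_poly_monom poly_monom)

context
  fixes n p :: nat and \<zeta> :: complex and F pp :: "complex set" and g g0 :: nat
  assumes n: "n > 0" and p: "prime p" and np: "n dvd p - 1" and zeta: "primitive_root n \<zeta>"
    and F: "F = gen_field {\<zeta>}" and pp: "prime_ideal_of (ring_of_integers F) pp" "of_nat p \<in> pp"
    and g: "residue_primroot p g" and g0: "g0 = g ^ ((p - 1) div n)"
begin

lemma zeta_pow_n: "\<zeta> ^ n = 1"
  using zeta by (simp add: primitive_root_def)

lemma F_eq: "F = rat_adjoin \<zeta>"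
  using gen_field_root_of_unity[OF zeta_pow_n n] F by simp

lemma subfield_F: "subfield F"
  by (simp add: F subfield_gen_field)

lemmas subring_OF = is_subring_ring_of_integers[OF subfield_F]

lemma zeta_integer: "algebraic_integer \<zeta>"
  using algebraic_integer_root_of_int[of \<zeta> n 1] zeta_pow_n n by simp

lemma zeta_in_OF: "\<zeta> \<in> ring_of_integers F"
  by (simp add: ring_of_integers_def zeta_integer F_eq generator_in_rat_adjoin)

lemma not_p_dvd_n: "\<not> p dvd n"
proof
  assume "p dvd n"
  then have "p \<le> n" using n by (simp add: dvd_imp_le)
  moreover have "n \<le> p - 1" using np prime_gt_1_nat[OF p] by (intro dvd_imp_le) auto
  ultimately show False using prime_gt_1_nat[OF p] by simp
qed

lemma n_notin_pp: "of_nat n \<notin> pp"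
  using prime_ideal_of_nat_iff[OF subring_OF pp(1) p pp(2)] not_p_dvd_n by blast

text \<open>A primitive root has order p - 1, so its power with exponent (p - 1) / n has order
  exactly n.\<close>

lemma g0_power_cong_1_iff: "[g0 ^ k = 1] (mod p) \<longleftrightarrow> n dvd k"
proof -
  define q where "q = (p - 1) div n"
  have qn: "p - 1 = q * n" using np by (simp add: q_def)
  have q0: "q > 0" using qn prime_gt_1_nat[OF p] by (cases q) auto
  have ord: "ord p g = p - 1" using g totient_prime[OF p] by (auto simp: residue_primroot_def)
  have "[g0 ^ k = 1] (mod p) \<longleftrightarrow> [g ^ (q * k) = 1] (mod p)" by (simp add: g0 q_def power_mult)
  also have "\<dots> \<longleftrightarrow> q * n dvd q * k" by (simp only: ord_divides ord qn)
  also have "\<dots> \<longleftrightarrow> n dvd k" using q0 by simp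
  finally show ?thesis .
qed

lemma cong_imp_diff_in_pp: "[a = b] (mod p) \<Longrightarrow> of_nat a - of_nat b \<in> pp"
proof -
  assume "[a = b] (mod p)"
  then have "int p dvd int a - int b" by (simp add: cong_iff_dvd_diff[symmetric] cong_int_iff)
  then have "of_int (int a - int b) \<in> pp" using prime_ideal_of_int_iff[OF subring_OF pp(1) p pp(2)] by blast
  then show ?thesis by simp
qed

text \<open>Modulo p, \<open>g0 ^ m\<close> is an n-th root of unity other than 1, so in the
  factorisation of its n-th power minus 1 the prime must contain the geometric sum.\<close>

lemma geometric_sum_in_pp:
  assumes "0 < m" "m < n"
  shows "(\<Sum>j<n. (of_nat g0 ^ m) ^ j) \<in> pp"
proof -
  note cl = subring_closed[OF subring_OF]
  let ?x = "of_nat g0 ^ m :: complex"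
  have "?x ^ n - 1 = (?x - 1) * (\<Sum>j<n. ?x ^ j)" by (rule power_diff_1_eq)
  moreover have "?x ^ n - 1 \<in> pp"
  proof -
    have "[(g0 ^ m) ^ n = 1] (mod p)"
      unfolding power_mult[symmetric] using g0_power_cong_1_iff by simp
    from cong_imp_diff_in_pp[OF this] show ?thesis by simp
  qed
  moreover have "?x - 1 \<in> ring_of_integers F" "(\<Sum>j<n. ?x ^ j) \<in> ring_of_integers F"
    by (intro cl)+
  ultimately have "?x - 1 \<in> pp \<or> (\<Sum>j<n. ?x ^ j) \<in> pp"
    using prime_ideal_prime[OF subring_OF pp(1)] by metis
  moreover have "?x - 1 \<notin> pp"
  proof
    assume "?x - 1 \<in> pp"
    then have "of_int (int (g0 ^ m) - int 1) \<in> pp" by simp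
    then have "int p dvd int (g0 ^ m) - int 1"
      using prime_ideal_of_int_iff[OF subring_OF pp(1) p pp(2)] by blast
    then have "[g0 ^ m = 1] (mod p)" by (simp only: cong_iff_dvd_diff[symmetric] cong_int_iff)
    then have "n dvd m" using g0_power_cong_1_iff by simp
    then show False using assms by (auto dest: dvd_imp_le)
  qed
  ultimately show ?thesis by blast
qed

text \<open>The cofactors \<open>E j\<close> of \<open>\<zeta> - g0 ^ j\<close> in \<open>\<zeta> ^ n - g0 ^ (j n)\<close> cannot all lie in the prime,
  since a combination of them is congruent to n.\<close>

lemma zeta_cong_primroot_power:
  "\<exists>b. coprime b n \<and> \<zeta> - of_nat (g0 ^ b) \<in> pp"
proof -
  note cl = subring_closed[OF subring_OF] zeta_in_OF
  define c where "c j = (of_nat (g0 ^ j) :: complex)" for j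
  define E where "E j = (\<Sum>k<n. c j ^ (n - Suc k) * \<zeta> ^ k)" for j
  have cR: "c j \<in> ring_of_integers F" for j unfolding c_def by (intro cl)
  have "\<exists>b. \<zeta> - c b \<in> pp"
  proof (rule ccontr)
    assume no: "\<nexists>b. \<zeta> - c b \<in> pp"
    have "E j \<in> pp" for j
    proof -
      have "\<zeta> ^ n - c j ^ n = (\<zeta> - c j) * E j" unfolding E_def by (rule power_diff_sumr2)
      moreover have "\<zeta> ^ n - c j ^ n \<in> pp"
      proof -
        have "[1 = (g0 ^ j) ^ n] (mod p)"
          unfolding power_mult[symmetric] using g0_power_cong_1_iff[of "j * n"] by (simp add: cong_sym_eq)
        from cong_imp_diff_in_pp[OF this] show ?thesis by (simp add: c_def zeta_pow_n)
      qed
      moreover have "\<zeta> - c j \<in> ring_of_integers F" "E j \<in> ring_of_integers F"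
        unfolding E_def by (intro cl cR)+
      ultimately have "\<zeta> - c j \<in> pp \<or> E j \<in> pp"
        using prime_ideal_prime[OF subring_OF pp(1)] by metis
      then show ?thesis using no by blast
    qed
    \<comment> \<open>Orthogonality of roots of unity: after exchanging the sums, the coefficient of
      \<open>\<zeta> ^ k\<close> is a geometric sum in \<open>g0 ^ (n - k)\<close>. It lies in
      \<open>pp\<close> for \<open>0 < k\<close> and is congruent to n for
      \<open>k = 0\<close>.\<close>
    then have "(\<Sum>j<n. c j * E j) \<in> pp"
      by (intro prime_ideal_sum[OF subring_OF pp(1)] prime_ideal_mult[OF subring_OF pp(1)] cR)
    also have "(\<Sum>j<n. c j * E j) = (\<Sum>j<n. \<Sum>k<n. \<zeta> ^ k * (of_nat g0 ^ (n - k)) ^ j)"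
    proof (intro sum.cong refl)
      fix j assume "j \<in> {..<n}"
      have "c j * (c j ^ (n - Suc k) * \<zeta> ^ k) = \<zeta> ^ k * (of_nat g0 ^ (n - k)) ^ j" if "k < n" for k
      proof -
        have "c j * c j ^ (n - Suc k) = c j ^ (n - k)" using that by (metis Suc_diff_Suc power_Suc)
        also have "\<dots> = (of_nat g0 ^ (n - k)) ^ j" by (simp add: c_def mult.commute flip: power_mult)
        finally show ?thesis by (metis mult.assoc mult.commute)
      qed
      then show "c j * E j = (\<Sum>k<n. \<zeta> ^ k * (of_nat g0 ^ (n - k)) ^ j)"
        unfolding E_def sum_distrib_left by (intro sum.cong) auto
    qed
    also have "\<dots> = (\<Sum>k<n. \<zeta> ^ k * (\<Sum>j<n. (of_nat g0 ^ (n - k)) ^ j))"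
      by (subst sum.swap) (simp add: sum_distrib_left)
    also have "\<dots> = (\<Sum>j<n. (of_nat g0 ^ n) ^ j) + (\<Sum>k\<in>{0<..<n}. \<zeta> ^ k * (\<Sum>j<n. (of_nat g0 ^ (n - k)) ^ j))"
    proof -
      have "{..<n} = insert 0 {0<..<n}" using n by auto
      then show ?thesis by simp
    qed
    finally have sum_in: "(\<Sum>j<n. (of_nat g0 ^ n) ^ j) + (\<Sum>k\<in>{0<..<n}. \<zeta> ^ k * (\<Sum>j<n. (of_nat g0 ^ (n - k)) ^ j)) \<in> pp" .
    have "(\<Sum>k\<in>{0<..<n}. \<zeta> ^ k * (\<Sum>j<n. (of_nat g0 ^ (n - k)) ^ j)) \<in> pp"
      by (intro prime_ideal_sum[OF subring_OF pp(1)] prime_ideal_mult[OF subring_OF pp(1)] cl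
          geometric_sum_in_pp) auto
    from prime_ideal_diff[OF subring_OF pp(1) sum_in this]
    have 1: "(\<Sum>j<n. (of_nat g0 ^ n) ^ j) \<in> pp" by simp
    have "(\<Sum>j<n. (of_nat g0 ^ n) ^ j - 1) \<in> pp"
    proof (intro prime_ideal_sum[OF subring_OF pp(1)])
      fix j
      have "[(g0 ^ n) ^ j = 1] (mod p)"
        unfolding power_mult[symmetric] using g0_power_cong_1_iff by simp
      from cong_imp_diff_in_pp[OF this] show "(of_nat g0 ^ n) ^ j - 1 \<in> pp" by simp
    qed
    from prime_ideal_diff[OF subring_OF pp(1) 1 this] have "of_nat n \<in> pp"
      by (simp add: sum_subtractf)
    then show False using n_notin_pp by simp
  qed
  then obtain b where b: "\<zeta> - c b \<in> pp" by blast
  \<comment> \<open>Reduction preserves the exact order n: otherwise some power \<omega> of \<zeta>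
    different from 1 would be congruent to 1, and the vanishing sum of its n powers would be
    congruent to n.\<close>
  have "coprime b n"
  proof (rule ccontr)
    assume "\<not> coprime b n"
    define d where "d = gcd b n"
    have d: "d \<noteq> 1" "d dvd b" "d dvd n" "d > 0"
      using \<open>\<not> coprime b n\<close> n by (auto simp: d_def coprime_iff_gcd_eq_1)
    define k where "k = n div d"
    have k: "n = d * k" "0 < k" "k < n"
      using d n by (auto simp: k_def intro!: div_less_dividend)
    obtain b' where b': "b = d * b'" using d by blast
    define \<omega> where "\<omega> = \<zeta> ^ k"
    have \<omega>R: "\<omega> \<in> ring_of_integers F" unfolding \<omega>_def by (intro cl)
    have "\<omega> \<noteq> 1" using zeta k by (simp add: \<omega>_def primitive_root_def)
    moreover have "\<omega> ^ n = 1" unfolding \<omega>_def using zeta_pow_n by (metis mult.commute power_mult power_one)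
    ultimately have sum0: "(\<Sum>j<n. \<omega> ^ j) = 0" by (simp add: sum_gp_strict)
    have "\<omega> - c b ^ k \<in> pp" unfolding \<omega>_def
      by (rule prime_ideal_power_cong[OF subring_OF pp(1) zeta_in_OF cR b])
    moreover have "c b ^ k - 1 \<in> pp"
    proof -
      have "n dvd b * k" unfolding k(1) b' by simp
      then have "[(g0 ^ b) ^ k = 1] (mod p)"
        unfolding power_mult[symmetric] using g0_power_cong_1_iff by simp
      from cong_imp_diff_in_pp[OF this] show ?thesis by (simp add: c_def)
    qed
    ultimately have \<omega>1: "\<omega> - 1 \<in> pp"
      using prime_ideal_add[OF subring_OF pp(1), of "\<omega> - c b ^ k" "c b ^ k - 1"] by simp
    have "(\<Sum>j<n. \<omega> ^ j - 1 ^ j) \<in> pp"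
      by (intro prime_ideal_sum[OF subring_OF pp(1)] prime_ideal_power_cong[OF subring_OF pp(1)] \<omega>R \<omega>1 cl)
    then have "- of_nat n \<in> pp" by (simp add: sum_subtractf sum0)
    then have "of_nat n \<in> pp" using prime_ideal_uminus[OF subring_OF pp(1)] by fastforce
    then show False using n_notin_pp by simp
  qed
  then show ?thesis using b by (auto simp: c_def)
qed

lemma OF_denominator:
  assumes "x \<in> ring_of_integers F"
  shows "\<exists>m h. coprime m p \<and> of_nat m * x = poly (map_poly of_int h) \<zeta>"
proof -
  have "coprime p n" using p not_p_dvd_n by (simp add: prime_imp_coprime)
  then obtain m where "coprime m p" "of_nat m * x \<in> int_adjoin \<zeta>"
    using algebraic_integer_denominator_coprime[OF zeta_pow_n p _ , of x] assms
    by (auto simp: ring_of_integers_def F_eq)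
  then show ?thesis by (auto simp: int_adjoin_def)
qed

lemma poly_of_int_of_nat: "poly (map_poly of_int h) (of_nat c) = complex_of_int (poly h (int c))"
  by (metis of_int_hom.poly_map_poly of_int_of_nat_eq)

context
  fixes c :: nat assumes c: "\<zeta> - of_nat c \<in> pp"
begin

text \<open>Up to a denominator m prime to p, x is a polynomial in \<zeta> and hence congruent to an
  integer, its value at c. Multiplying by an inverse of m modulo p gives a representative below
  p.\<close>

lemma residue_card_OF: "residue_card (ring_of_integers F) pp = p"
proof (rule residue_card_eq[OF subring_OF pp(1) p pp(2)])
  note cl = subring_closed[OF subring_OF]
  fix x assume x: "x \<in> ring_of_integers F"
  obtain m h where m: "coprime m p" "of_nat m * x = poly (map_poly of_int h) \<zeta>"
    using OF_denominator[OF x] by blast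
  define N where "N = poly h (int c)"
  have "of_nat m * x - of_int N \<in> pp"
    using prime_ideal_poly_cong[OF subring_OF pp(1) zeta_in_OF cl(8) c, of h]
    by (simp add: m N_def poly_of_int_of_nat)
  obtain m' where m': "[m * m' = 1] (mod p)" using cong_solve_coprime_nat[OF m(1)] by auto
  have p0: "p > 0" using p prime_gt_0_nat by blast
  define i where "i = nat ((int m' * N) mod int p)"
  have i: "i < p" using p0 by (simp add: i_def nat_less_iff)
  have "int i = (int m' * N) mod int p" using p0 by (simp add: i_def)
  then have "int p dvd int m' * N - int i" by (metis dvd_minus_mod)
  then have 1: "of_int (int m' * N - int i) \<in> pp"
    using prime_ideal_of_int_iff[OF subring_OF pp(1) p pp(2)] by blast
  have 2: "of_nat m' * (of_nat m * x - of_int N) \<in> pp"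
    by (rule prime_ideal_mult[OF subring_OF pp(1) cl(8)]) fact
  have 3: "(of_nat (m * m') - of_nat 1) * x \<in> pp"
    by (rule prime_ideal_mult_right[OF subring_OF pp(1) x cong_imp_diff_in_pp[OF m']])
  have "x - of_nat i = of_nat m' * (of_nat m * x - of_int N) + of_int (int m' * N - int i)
      - (of_nat (m * m') - of_nat 1) * x"
    by (simp add: algebra_simps)
  also have "\<dots> \<in> pp"
    by (intro prime_ideal_diff[OF subring_OF pp(1)] prime_ideal_add[OF subring_OF pp(1)] 1 2 3)
  finally show "\<exists>i<p. x - of_nat i \<in> pp" using i by blast
qed

text \<open>Lying over, made explicit: \<open>(p, \<zeta> - c)\<close> is proper in the larger ring because its cofactor
  \<open>\<gamma> = (\<zeta> ^ n - c ^ n) / (\<zeta> - c)\<close> would otherwise be divisible by p, although \<open>\<gamma> \<equiv> n c ^ (n - 1)\<close>.\<close>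

lemma exists_prime_above_pp:
  assumes L: "subfield L" "F \<subseteq> L"
  shows "\<exists>Q. prime_ideal_of (ring_of_integers L) Q \<and> pp \<subseteq> Q"
proof -
  let ?R = "ring_of_integers L"
  have R: "is_subring ?R" by (rule is_subring_ring_of_integers[OF L(1)])
  note cl = subring_closed[OF R]
  note clF = subring_closed[OF subring_OF] zeta_in_OF
  have FL: "x \<in> ?R" if "x \<in> ring_of_integers F" for x using that L(2) by (auto simp: ring_of_integers_def)
  \<comment> \<open>\<open>I\<close> is the principal ideal of p and \<open>J\<close> the ideal
    generated by p and \<zeta> - c, both shaped to fit
    \<open>is_ideal_add_principal\<close>.\<close>
  define I where "I = {m + r * of_nat p | m r. m \<in> {0} \<and> r \<in> ?R}"
  define J where "J = {m + r * (\<zeta> - of_nat c) | m r. m \<in> I \<and> r \<in> ?R}"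
  have zc: "\<zeta> - of_nat c \<in> ?R" by (intro cl FL zeta_in_OF)
  have "is_ideal ?R {0}" using cl by (simp add: is_ideal_def)
  then have I: "is_ideal ?R I" unfolding I_def by (rule is_ideal_add_principal[OF R]) (rule cl)
  then have J: "is_ideal ?R J" unfolding J_def by (rule is_ideal_add_principal[OF R _ zc])
  define \<gamma> where "\<gamma> = (\<Sum>k<n. of_nat c ^ (n - Suc k) * \<zeta> ^ k)"
  have \<gamma>F: "\<gamma> \<in> ring_of_integers F" unfolding \<gamma>_def by (intro clF)
  have \<gamma>: "(\<zeta> - of_nat c) * \<gamma> = 1 - of_nat c ^ n"
    unfolding \<gamma>_def power_diff_sumr2[symmetric] by (simp add: zeta_pow_n)
  have cn: "\<zeta> ^ n - of_nat c ^ n \<in> pp"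
    by (rule prime_ideal_power_cong[OF subring_OF pp(1) zeta_in_OF clF(8) c])
  then have "of_int (1 - int c ^ n) \<in> pp" by (simp add: zeta_pow_n)
  then have cn': "int p dvd 1 - int c ^ n"
    using prime_ideal_of_int_iff[OF subring_OF pp(1) p pp(2)] by blast
  then obtain k where k: "1 - int c ^ n = int p * k" by blast
  have pc: "\<not> p dvd c"
  proof
    assume "p dvd c"
    then have "int p dvd int c ^ n" using n by (simp add: dvd_power_le[of _ _ 1 n, simplified] Suc_leI)
    then have "int p dvd 1" using cn' by (metis dvd_add diff_add_cancel)
    then show False using p by (simp add: not_prime_unit)
  qed
  have \<gamma>pp: "\<gamma> \<notin> pp"
  proof
    assume "\<gamma> \<in> pp"
    have "(\<Sum>k<n. of_nat c ^ (n - Suc k) * (\<zeta> ^ k - of_nat c ^ k)) \<in> pp"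
      by (intro prime_ideal_sum[OF subring_OF pp(1)] prime_ideal_mult[OF subring_OF pp(1)]
          prime_ideal_power_cong[OF subring_OF pp(1)] clF c)
    also have "(\<Sum>k<n. of_nat c ^ (n - Suc k) * (\<zeta> ^ k - of_nat c ^ k)) =
        \<gamma> - (\<Sum>k<n. of_nat c ^ (n - Suc k) * of_nat c ^ k)"
      by (simp add: \<gamma>_def right_diff_distrib sum_subtractf)
    also have "(\<Sum>k<n. of_nat c ^ (n - Suc k) * of_nat c ^ k) = (\<Sum>k<n. of_nat c ^ (n - 1) :: complex)"
      by (intro sum.cong refl) (auto simp flip: power_add)
    also have "\<dots> = of_nat (n * c ^ (n - 1))" by simp
    finally have "of_nat (n * c ^ (n - 1)) \<in> pp"
      using prime_ideal_diff[OF subring_OF pp(1) \<open>\<gamma> \<in> pp\<close>] by fastforce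
    then have "p dvd n * c ^ (n - 1)"
      using prime_ideal_of_nat_iff[OF subring_OF pp(1) p pp(2)] by blast
    then show False using p pc not_p_dvd_n by (meson prime_dvd_mult_iff prime_dvd_power)
  qed
  have "1 \<notin> J"
  proof
    assume "1 \<in> J"
    then obtain r t where rt: "1 = r * of_nat p + t * (\<zeta> - of_nat c)" "r \<in> ?R" "t \<in> ?R"
      by (auto simp: J_def I_def)
    define u where "u = r * \<gamma> + t * of_int k"
    \<comment> \<open>Since (\<zeta> - c) \<gamma> = 1 - c ^ n is a multiple of p, so is \<gamma>.
      The quotient \<open>u\<close> is built in the integers of \<open>L\<close> but also lies in
      \<open>F\<close>, which forces \<gamma> into \<open>pp\<close>.\<close>
    have "\<gamma> = (r * of_nat p + t * (\<zeta> - of_nat c)) * \<gamma>" using rt(1) by simp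
    also have "\<dots> = r * of_nat p * \<gamma> + t * (1 - of_nat c ^ n)" unfolding \<gamma>[symmetric] by (simp add: algebra_simps)
    also have "1 - of_nat c ^ n = (of_nat p * of_int k :: complex)"
      using arg_cong[OF k, of complex_of_int] by simp
    finally have \<gamma>u: "\<gamma> = u * of_nat p" by (simp add: u_def algebra_simps)
    have "u \<in> ?R" unfolding u_def by (intro cl rt FL \<gamma>F)
    moreover have "u = \<gamma> / of_nat p" using \<gamma>u prime_gt_0_nat[OF p] by simp
    then have "u \<in> F" using \<gamma>F subfield_divide[OF subfield_F] subring_of_nat[OF subfield_is_subring[OF subfield_F]]
      by (simp add: ring_of_integers_def)
    ultimately have "u \<in> ring_of_integers F" by (simp add: ring_of_integers_def)
    then have "\<gamma> \<in> pp" unfolding \<gamma>u by (rule prime_ideal_mult[OF subring_OF pp(1) _ pp(2)])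
    then show False using \<gamma>pp by simp
  qed
  then obtain Q where Q: "prime_ideal_of ?R Q" "J \<subseteq> Q"
    using exists_prime_ideal_above[OF R J] by blast
  have pQ: "of_nat p \<in> Q"
  proof -
    have "of_nat p = (0 + 1 * of_nat p) + 0 * (\<zeta> - of_nat c)" by simp
    moreover have "0 + 1 * of_nat p \<in> I" unfolding I_def using cl(2) by blast
    ultimately have "of_nat p \<in> J" unfolding J_def using cl(1) by blast
    then show ?thesis using Q by blast
  qed
  have zQ: "\<zeta> - of_nat c \<in> Q"
  proof -
    have "\<zeta> - of_nat c = 0 + 1 * (\<zeta> - of_nat c)" by simp
    moreover have "0 \<in> I" using I by (simp add: is_ideal_def)
    ultimately have "\<zeta> - of_nat c \<in> J" unfolding J_def using cl(2) by blast
    then show ?thesis using Q by blast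
  qed
  \<comment> \<open>Apart from a denominator prime to p, x is congruent to the integer
    \<open>poly h (int c)\<close> modulo both primes; both contain the same integers, the multiples
    of p.\<close>
  have "x \<in> Q" if x: "x \<in> pp" for x
  proof -
    have xF: "x \<in> ring_of_integers F" by (rule prime_ideal_subset[OF subring_OF pp(1) x])
    obtain m h where m: "coprime m p" "of_nat m * x = poly (map_poly of_int h) \<zeta>"
      using OF_denominator[OF xF] by blast
    have diff: "of_nat m * x - of_int (poly h (int c)) \<in> P"
      if "is_subring R" "prime_ideal_of R P" "\<zeta> \<in> R" "\<zeta> - of_nat c \<in> P" for R P
      using prime_ideal_poly_cong[OF that(1,2,3) subring_of_nat[OF that(1)] that(4), of h]
      by (simp add: m poly_of_int_of_nat)
    have "of_nat m * x \<in> pp" by (rule prime_ideal_mult[OF subring_OF pp(1) clF(8) x])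
    from prime_ideal_diff[OF subring_OF pp(1) this diff[OF subring_OF pp(1) zeta_in_OF c]]
    have "of_int (poly h (int c)) \<in> pp" by simp
    then have "of_int (poly h (int c)) \<in> Q"
      using prime_ideal_of_int_iff[OF subring_OF pp(1) p pp(2)] prime_ideal_of_int_iff[OF R Q(1) p pQ] by blast
    from prime_ideal_add[OF R Q(1) diff[OF R Q(1) FL[OF zeta_in_OF] zQ] this]
    have "of_nat m * x \<in> Q" by simp
    then have "of_nat m \<in> Q \<or> x \<in> Q"
      using prime_ideal_prime[OF R Q(1) cl(8) FL[OF xF]] by blast
    moreover have "of_nat m \<notin> Q"
      using prime_ideal_of_nat_iff[OF R Q(1) p pQ] m(1) p
      by (metis coprime_absorb_right coprime_commute not_prime_unit)
    ultimately show ?thesis by blast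
  qed
  then show ?thesis using Q(1) by blast
qed

end

end

section \<open>The Kummer extension\<close>

text \<open>The factor \<open>f\<close> carries the scalars produced by automorphisms applied
  earlier in the composition.\<close>

lemma is_aut_funpow_eigenvector:
  assumes \<sigma>: "is_aut L F \<sigma>" and F: "subfield F" "F \<subseteq> L"
    and c: "c \<in> F" and x: "x \<in> L" "\<sigma> x = c * x" and f: "f \<in> F"
  shows "(\<sigma> ^^ k) (f * x) = c ^ k * (f * x)"
proof (induction k)
  case (Suc k)
  have "c ^ k * f \<in> F" using subring_closed[OF subfield_is_subring[OF F(1)]] c f by simp
  then have "\<sigma> (c ^ k * f * x) = c ^ k * f * \<sigma> x"
    using \<sigma> F(2) x(1) by (auto simp: is_aut_def)
  then show ?case using Suc x(2) by (simp add: mult_ac)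
qed simp

lemma foldr_kummer_automorphisms:
  fixes lam :: "nat \<Rightarrow> complex \<Rightarrow> complex"
  assumes F: "subfield F" "F \<subseteq> L" "\<zeta> \<in> F" and r: "\<And>i. i < s \<Longrightarrow> r i \<in> L"
    and aut: "\<And>i. i < s \<Longrightarrow> is_aut L F (lam i)"
    and lam_i: "\<And>i. i < s \<Longrightarrow> lam i (r i) = \<zeta> * r i"
    and lam_j: "\<And>i j. i < s \<Longrightarrow> j < s \<Longrightarrow> j \<noteq> i \<Longrightarrow> lam i (r j) = r j"
    and j: "j < s"
  shows "foldr (\<lambda>i f. (lam i ^^ a i) \<circ> f) [0..<s] id (r j) = \<zeta> ^ a j * r j"
proof -
  note cl = subring_closed[OF subfield_is_subring[OF F(1)]]
  \<comment> \<open>The eigenvalue of \<open>r j\<close> is \<zeta> for the automorphism with the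
    same index and 1 for all others.\<close>
  have step: "(lam i ^^ k) (f * r j) = (if i = j then \<zeta> ^ k * (f * r j) else f * r j)"
    if "i < s" "f \<in> F" for i k f
    using is_aut_funpow_eigenvector[OF aut[OF that(1)] F r[OF j] _ that(2), of k]
      is_aut_funpow_eigenvector[OF aut[OF that(1)] F(1,2) cl(2) r[OF j] _ that(2), of k]
      lam_i[OF that(1)] lam_j[OF that(1) j]
    by auto
  have "foldr (\<lambda>i f. (lam i ^^ a i) \<circ> f) xs id (r j) = (if j \<in> set xs then \<zeta> ^ a j else 1) * r j"
    if "distinct xs" "set xs \<subseteq> {..<s}" for xs
    using that
  proof (induction xs)
    case (Cons i xs)
    have "(if j \<in> set xs then \<zeta> ^ a j else 1) \<in> F" using cl F(3) by auto
    from step[OF _ this, of i "a i"] Cons show ?case by auto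
  qed simp
  from this[of "[0..<s]"] show ?thesis using j by (simp add: atLeast0LessThan)
qed

theorem theorem3p11:
  fixes n p s :: nat and l :: "nat \<Rightarrow> nat" and a :: "nat \<Rightarrow> nat"
    and \<zeta> \<zeta>p :: complex and r :: "nat \<Rightarrow> complex"
    and lam :: "nat \<Rightarrow> complex \<Rightarrow> complex"
    and F L K pp :: "complex set"
  assumes n: "n \<ge> 1"
    and p: "prime p" "p mod n = 1 mod n"
    and l_prime: "\<forall>i<s. prime (l i)"
    and l_dist: "inj_on l {..<s}"
    and l_ne_p: "\<forall>i<s. l i \<noteq> p"
    and l_ndvd: "\<forall>i<s. \<not> l i dvd n"
    and zeta: "primitive_root n \<zeta>"
    and F_def: "F = gen_field {\<zeta>}"
    and roots: "\<forall>i<s. r i ^ n = of_nat (l i)"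
    and L_def: "L = gen_field ({\<zeta>} \<union> r ` {..<s})"
    and lam_aut: "\<forall>i<s. is_aut L F (lam i)"
    and lam_i: "\<forall>i<s. lam i (r i) = \<zeta> * r i"
    and lam_j: "\<forall>i<s. \<forall>j<s. j \<noteq> i \<longrightarrow> lam i (r j) = r j"
    and zetap: "primitive_root p \<zeta>p"
    and K_sub: "subfield K" "K \<subseteq> gen_field {\<zeta>p}"
    and K_deg: "degree_over_Q K n"
    and wp: "prime_ideal_of (ring_of_integers F) pp" "of_nat p \<in> pp"
    and frob: "is_frobenius L F pp (foldr (\<lambda>i f. (lam i ^^ a i) \<circ> f) [0..<s] id)"
  shows "\<exists>\<tau>. gal_generator K \<rat> \<tau> \<and> (\<forall>i<s. is_frobenius_Q K (l i) (\<tau> ^^ a i))"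
proof -
  have n0: "n > 0" and p0: "p > 0" and p1: "p > 1" using n prime_gt_0_nat prime_gt_1_nat p(1) by auto
  have np: "n dvd p - 1" using p(2) p1 by (metis less_imp_le mod_eq_dvd_iff_nat)
  define q where "q = (p - 1) div n"
  have qn: "p - 1 = q * n" using np by (simp add: q_def)
  have q0: "q > 0" using qn p1 by (cases q) auto
  obtain g where g: "residue_primroot p g" using prime_primitive_root_exists[of p] p(1) p1 by auto
  note FL = n0 p(1) np zeta F_def wp g refl
  obtain b where b: "coprime b n" "\<zeta> - of_nat ((g ^ q) ^ b) \<in> pp"
    using zeta_cong_primroot_power[OF FL] unfolding q_def by blast
  define c where "c = (g ^ q) ^ b"
  have c: "\<zeta> - of_nat c \<in> pp" using b by (simp add: c_def)
  have F: "subfield F" and L: "subfield L" by (auto simp: F_def L_def subfield_gen_field)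
  have inL: "\<zeta> \<in> L" "\<And>i. i < s \<Longrightarrow> r i \<in> L"
    unfolding L_def using gen_field_incl[of "{\<zeta>} \<union> r ` {..<s}"] by auto
  have FsubL: "F \<subseteq> L" unfolding F_def by (rule gen_field_least[OF L]) (use inL in simp)
  have zF: "\<zeta> \<in> F" unfolding F_def using gen_field_incl by blast
  obtain Q where Q: "prime_ideal_of (ring_of_integers L) Q" "pp \<subseteq> Q"
    using exists_prime_above_pp[OF FL c L FsubL] by blast
  note R = is_subring_ring_of_integers[OF L]
  note cl = subring_closed[OF R]
  have pQ: "of_nat p \<in> Q" "\<zeta> - of_nat c \<in> Q" using Q(2) wp(2) c by auto
  have zR: "\<zeta> \<in> ring_of_integers L"
    using inL(1) zeta_integer[OF FL] by (simp add: ring_of_integers_def)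
  define \<sigma> where "\<sigma> = foldr (\<lambda>i f. (lam i ^^ a i) \<circ> f) [0..<s] id"
  have exponent: "\<exists>d. [l i = g ^ d] (mod p) \<and> [b * a i = d] (mod n)" if i: "i < s" for i
  proof -
    have li: "prime (l i)" "l i \<noteq> p" "r i ^ n = of_nat (l i)" using i l_prime l_ne_p roots by auto
    have ndvd: "\<not> p dvd l i" using li p(1) by (metis primes_dvd_imp_eq)
    have "algebraic_integer (r i)"
      using algebraic_integer_root_of_int[of "r i" n "int (l i)"] li(3) n0 by simp
    then have rR: "r i \<in> ring_of_integers L" using inL(2)[OF i] by (simp add: ring_of_integers_def)
    have "\<sigma> (r i) = \<zeta> ^ a i * r i" unfolding \<sigma>_def
      by (rule foldr_kummer_automorphisms[OF F FsubL zF inL(2)])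
         (use lam_aut lam_i lam_j i in auto)
    moreover have "\<sigma> (r i) - r i ^ p \<in> Q"
      using frob Q rR residue_card_OF[OF FL c] unfolding is_frobenius_def \<sigma>_def by auto
    \<comment> \<open>From p = 1 + n q, the Frobenius power of the n-th root splits off an honest
      integer.\<close>
    moreover have "r i ^ p = r i * of_nat (l i ^ q)"
    proof -
      have "p = Suc (n * q)" using qn p1 by (simp add: mult.commute)
      then have "r i ^ p = r i * (r i ^ n) ^ q" by (metis power_Suc power_mult)
      then show ?thesis by (simp add: li(3))
    qed
    ultimately have "r i * (\<zeta> ^ a i - of_nat (l i ^ q)) \<in> Q" by (simp add: algebra_simps)
    moreover have "\<zeta> ^ a i - of_nat (l i ^ q) \<in> ring_of_integers L" by (intro cl zR)
    \<comment> \<open>This permits cancelling \<open>r i\<close>: its n-th power is a prime number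
      other than p.\<close>
    moreover have "r i \<notin> Q"
    proof
      assume ri: "r i \<in> Q"
      have "r i ^ n = r i ^ (n - 1) * r i" using n0 by (metis Suc_diff_1 power_Suc2)
      then have "of_nat (l i) \<in> Q"
        using prime_ideal_mult[OF R Q(1) subring_power[OF R rR] ri] by (metis li(3))
      then show False using prime_ideal_of_nat_iff[OF R Q(1) p(1) pQ(1)] ndvd by blast
    qed
    ultimately have "\<zeta> ^ a i - of_nat (l i ^ q) \<in> Q"
      using prime_ideal_prime[OF R Q(1) rR] by blast
    moreover have "\<zeta> ^ a i - of_nat c ^ a i \<in> Q"
      by (rule prime_ideal_power_cong[OF R Q(1) zR cl(8) pQ(2)])
    ultimately have "(\<zeta> ^ a i - of_nat (l i ^ q)) - (\<zeta> ^ a i - of_nat c ^ a i) \<in> Q"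
      by (rule prime_ideal_diff[OF R Q(1)])
    then have "of_int (int (c ^ a i) - int (l i ^ q)) \<in> Q" by simp
    then have "int p dvd int (c ^ a i) - int (l i ^ q)"
      using prime_ideal_of_int_iff[OF R Q(1) p(1) pQ(1)] by blast
    then have cong: "[c ^ a i = l i ^ q] (mod p)"
      by (simp only: cong_iff_dvd_diff[symmetric] cong_int_iff)
    have "l i mod p \<in> totatives p"
      using ndvd p(1) p1 by (simp add: totatives_prime dvd_eq_mod_eq_0)
    then have "l i mod p \<in> (\<lambda>d. g ^ d mod p) ` {..<totient p}"
      by (simp only: bij_betw_imp_surj_on[OF residue_primroot_is_generator[OF p1 g]])
    then obtain d where "l i mod p = g ^ d mod p" by (elim imageE)
    then have ld: "[l i = g ^ d] (mod p)" by (simp only: cong_def)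
    have "[c ^ a i = (g ^ d) ^ q] (mod p)" using cong cong_pow[OF ld] by (rule cong_trans)
    then have "[g ^ (q * (b * a i)) = g ^ (q * d)] (mod p)"
      unfolding c_def power_mult[symmetric] by (simp only: mult.assoc mult.commute[of d q])
    moreover have "coprime p g" "ord p g = q * n"
      using g totient_prime[OF p(1)] qn by (auto simp: residue_primroot_def)
    \<comment> \<open>Equal powers of a primitive root give exponents congruent modulo p - 1 = q n;
      cancelling q leaves the modulus n.\<close>
    ultimately have "[q * (b * a i) = q * d] (mod (q * n))"
      using order_divides_expdiff by metis
    then have "[b * a i = d] (mod n)" using q0 by (simp add: cong_def mod_mult_mult1)
    then show ?thesis using ld by blast
  qed
  have KM: "K \<subseteq> rat_adjoin \<zeta>p"
    using K_sub(2) gen_field_root_of_unity[OF zeta_pow_p[OF p(1) zetap] p0] by simp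
  note KK = p(1) zetap g K_sub(1) KM K_deg
  show ?thesis
  proof (intro exI conjI allI impI)
    show "gal_generator K \<rat> (primroot_conj \<zeta>p g b)" by (rule gal_generator_primroot_conj[OF KK b(1)])
    fix i assume i: "i < s"
    then obtain d where "[l i = g ^ d] (mod p)" "[b * a i = d] (mod n)" using exponent by blast
    then show "is_frobenius_Q K (l i) (primroot_conj \<zeta>p g b ^^ a i)"
      using is_frobenius_primroot_conj_funpow[OF KK] l_prime l_ne_p i by blast
  qed
qed

end
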